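(* For any graph $G$ and any integers $k\geq\mathrm{tw}(G)+1$ and $d\geq 2$, $G$ has a $(d-1)$-slick weak tree-decomposition of width at most $18kd$, degree at most $6d$, and order at most $\max\{\frac{|V(G)|}{2k},1\}$, in which each vertex $v\in V(G)$ has spread at most $1+\frac{\deg_G(v)}{d-1}$.
   Context: Graphs are simple, undirected and finite; $\mathrm{tw}(G)$ is the treewidth of $G$. For a non-empty tree $T$, a weak $T$-decomposition of $G$ is a collection $(B_x:x\in V(T))$ of subsets $B_x\subseteq V(G)$ such that for each edge $vw\in E(G)$ there is an edge $xy\in E(T)$ with $v,w\in B_x\cup B_y$, and for each $v\in V(G)$ the set $\{x\in V(T):v\in B_x\}$ induces a non-empty connected subtree of $T$. A weak tree-decomposition is a weak $T$-decomposition for some tree $T$; its width is $\max_x|B_x|-1$, its degree is the maximum degree of $T$, its order is $|V(T)|$, and the spread of $v$ is the number of nodes $x$ with $v\in B_x$. It is rooted if $T$ is rooted. For an integer $s\ge1$, a rooted weak tree-decomposition is $s$-slick if for each edge $xy\in E(T)$ with $x$ the parent of $y$, and each $v\in B_x\cap B_y$, we have $|(N_G(v)\cap B_y)\setminus B_x|\geq s$.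
   Formalization: In a weak T-decomposition, both ends of an edge of G may also lie in a single bag (x = y allowed), so a one-node tree can cover edges; with the literal definition the claim fails, e.g. for G = K_2, k = d = 2. For trees with at least two nodes the definitions agree. *)

theory Defs
  imports Complex_Main "Graph_Theory.Graph_Theory"
begin

text \<open>
  A finite simple undirected graph is a symmetric loop-free finite digraph without parallel arcs,
  \<^locale>\<open>pair_graph\<close>: an undirected edge is represented by its two opposite arcs, so the degree of
  a vertex is its out-degree.
\<close>

abbreviation neighbours :: "'a pair_pre_digraph \<Rightarrow> 'a \<Rightarrow> 'a set" where
  "neighbours G v \<equiv> {w. (v, w) \<in> parcs G}"

abbreviation degree :: "'a pair_pre_digraph \<Rightarrow> 'a \<Rightarrow> nat" where
  "degree G v \<equiv> out_degree (with_proj G) v"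

text \<open>
  The library's \<^const>\<open>tree\<close> cannot be used for symmetric digraphs, because it counts the
  two opposite arcs of an edge as a cycle. A directed cycle of length at least 3
  is exactly a traversal of an undirected cycle. Note that \<^const>\<open>Digraph_Component.connected\<close>
  includes non-emptiness.
\<close>

definition undirected_tree :: "'b pair_pre_digraph \<Rightarrow> bool" where
  "undirected_tree T \<longleftrightarrow> pair_graph T \<and> Digraph_Component.connected (with_proj T) \<and>
     \<not> (\<exists>p. pre_digraph.cycle (with_proj T) p \<and> length p \<ge> 3)"

definition bag_nodes :: "'b pair_pre_digraph \<Rightarrow> ('b \<Rightarrow> 'a set) \<Rightarrow> 'a \<Rightarrow> 'b set" where
  "bag_nodes T B v = {x \<in> pverts T. v \<in> B x}"

definition tree_bags :: "'a pair_pre_digraph \<Rightarrow> 'b pair_pre_digraph \<Rightarrow> ('b \<Rightarrow> 'a set) \<Rightarrow> bool" where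
  "tree_bags G T B \<longleftrightarrow> undirected_tree T \<and> (\<forall>x\<in>pverts T. B x \<subseteq> pverts G) \<and>
     (\<forall>v\<in>pverts G. Digraph_Component.connected (with_proj T \<restriction> bag_nodes T B v))"

definition tree_decomposition ::
    "'a pair_pre_digraph \<Rightarrow> 'b pair_pre_digraph \<Rightarrow> ('b \<Rightarrow> 'a set) \<Rightarrow> bool" where
  "tree_decomposition G T B \<longleftrightarrow> tree_bags G T B \<and>
     (\<forall>(v, w)\<in>parcs G. \<exists>x\<in>pverts T. v \<in> B x \<and> w \<in> B x)"

text \<open>
  The case \<open>x = y\<close> matters only if \<open>T\<close> has a single node (otherwise every node
  has a neighbour); a one-node tree has no edges, and its single bag is meant to be allowed to
  contain the edges of \<open>G\<close>.
\<close>

definition weak_tree_decomposition ::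
    "'a pair_pre_digraph \<Rightarrow> 'b pair_pre_digraph \<Rightarrow> ('b \<Rightarrow> 'a set) \<Rightarrow> bool" where
  "weak_tree_decomposition G T B \<longleftrightarrow> tree_bags G T B \<and>
     (\<forall>(v, w)\<in>parcs G. \<exists>x\<in>pverts T. \<exists>y\<in>pverts T.
        ((x, y) \<in> parcs T \<or> x = y) \<and> v \<in> B x \<union> B y \<and> w \<in> B x \<union> B y)"

definition width :: "'b pair_pre_digraph \<Rightarrow> ('b \<Rightarrow> 'a set) \<Rightarrow> int" where
  "width T B = int (Max ((\<lambda>x. card (B x)) ` pverts T)) - 1"

text \<open>
  Every finite tree is isomorphic to one with nodes in \<^typ>\<open>nat\<close>, so ranging over those loses
  nothing. The graph without vertices has treewidth \<open>-1\<close>.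
\<close>

definition treewidth :: "'a pair_pre_digraph \<Rightarrow> int" where
  "treewidth G =
     Inf {width T B | (T :: nat pair_pre_digraph) B. tree_decomposition G T B}"

definition max_degree :: "'b pair_pre_digraph \<Rightarrow> nat" where
  "max_degree T = Max (degree T ` pverts T)"

definition spread :: "'b pair_pre_digraph \<Rightarrow> ('b \<Rightarrow> 'a set) \<Rightarrow> 'a \<Rightarrow> nat" where
  "spread T B v = card (bag_nodes T B v)"

text \<open>In the tree \<open>T\<close> rooted at \<open>r\<close>, the parent of \<open>y\<close> is the node preceding \<open>y\<close> on the path
  from \<open>r\<close> to \<open>y\<close>.\<close>

definition is_parent :: "'b pair_pre_digraph \<Rightarrow> 'b \<Rightarrow> 'b \<Rightarrow> 'b \<Rightarrow> bool" where
  "is_parent T r x y \<longleftrightarrow> (\<exists>p. pre_digraph.apath (with_proj T) r (p @ [(x, y)]) y)"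

definition slick ::
    "nat \<Rightarrow> 'a pair_pre_digraph \<Rightarrow> 'b pair_pre_digraph \<Rightarrow> 'b \<Rightarrow> ('b \<Rightarrow> 'a set) \<Rightarrow> bool" where
  "slick s G T r B \<longleftrightarrow>
     (\<forall>x y. is_parent T r x y \<longrightarrow>
        (\<forall>v\<in>B x \<inter> B y. card ((neighbours G v \<inter> B y) - B x) \<ge> s))"

end

theory Submission
  imports Defs "HOL-Library.Countable"
begin

text \<open>
  Fix a tree-decomposition with bags of size at most \<open>k\<close>. By induction, for all vertex sets
  \<open>S \<subseteq> U\<close> with \<open>4k \<le> |S| \<le> 12kd\<close> the graph induced by \<open>U\<close> has a slick decomposition whose root
  bag contains \<open>S\<close>. If \<open>|S| > 12k\<close>, a bag of the given tree-decomposition splits \<open>U\<close> and \<open>S\<close>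
  in a balanced way, and the decompositions of the two sides are glued at their roots. Otherwise \<open>S\<close>
  is made the root bag; a vertex of \<open>S\<close> with at least \<open>d\<close> neighbours outside \<open>S\<close> is repeated in
  the next bag together with \<open>d - 1\<close> of them, while for any other vertex of \<open>S\<close> all these neighbours
  are put there. Padding that bag to at least \<open>6k\<close> new vertices keeps the
  order \<open>N\<close> within the bound \<open>6kN + |S| \<le> 3|U| + 4k\<close>, which is stable under both steps.
\<close>

section \<open>Connectedness in symmetric digraphs\<close>

text \<open>Connectedness goes through the symmetric closure of the arcs, which adds nothing to a
  symmetric arc set. Since \<open>rtrancl_on X\<close> already confines walks to \<open>X\<close>,
  restricting the arcs to \<open>X\<close> does not change it.\<close>

lemma connected_induce_iff:
  assumes "sym (parcs T)"
  shows "Digraph_Component.connected (with_proj T \<restriction> X) \<longleftrightarrow>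
    X \<noteq> {} \<and> (\<forall>u\<in>X. \<forall>v\<in>X. (u, v) \<in> rtrancl_on X (parcs T))"
proof -
  have ends: "arcs_ends (with_proj T \<restriction> X) = parcs T \<inter> X \<times> X"
    by (auto simp: arcs_ends_conv image_def)
  have symcl: "(parcs T \<inter> X \<times> X)\<^sup>s = parcs T \<inter> X \<times> X"
    using assms by (auto simp: symcl_def sym_def)
  have "(u, v) \<in> rtrancl_on X (parcs T)" if "(u, v) \<in> rtrancl_on X (parcs T \<inter> X \<times> X)" for u v
    using that by (rule rtrancl_on_mono[rotated 2]) auto
  moreover have "(u, v) \<in> rtrancl_on X (parcs T \<inter> X \<times> X)" if "(u, v) \<in> rtrancl_on X (parcs T)" for u v
    using that by (induct rule: rtrancl_on_induct) (auto intro: rtrancl_on_into_rtrancl_on)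
  ultimately show ?thesis
    unfolding connected_conv ends symcl induce_subgraph_verts by blast
qed

lemma connected_with_proj_iff:
  assumes "sym (parcs T)"
  shows "Digraph_Component.connected (with_proj T) \<longleftrightarrow>
    pverts T \<noteq> {} \<and> (\<forall>u\<in>pverts T. \<forall>v\<in>pverts T. (u, v) \<in> rtrancl_on (pverts T) (parcs T))"
proof -
  have "(parcs T)\<^sup>s = parcs T"
    using assms by (auto simp: symcl_def sym_def)
  then show ?thesis
    by (simp add: connected_conv)
qed

lemma sym_parcs:
  assumes "pair_graph T"
  shows "sym (parcs T)"
proof -
  interpret pair_graph T by fact
  show ?thesis by (auto intro: symI arcs_symmetric)
qed

section \<open>Separators from a tree-decomposition\<close>

text \<open>For an arc \<open>(y, z)\<close> of a tree, this is the component of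
  \<open>T - y\<close> that contains \<open>z\<close>.\<close>

definition branch :: "'b pair_pre_digraph \<Rightarrow> 'b \<Rightarrow> 'b \<Rightarrow> 'b set" where
  "branch T y z = {w. (z, w) \<in> rtrancl_on (pverts T - {y}) (parcs T)}"

lemma branch_subset: "branch T y z \<subseteq> pverts T - {y}"
  by (auto simp: branch_def dest: in_rtrancl_on_in_F)

lemma branch_closed:
  "u \<in> branch T y z \<Longrightarrow> (u, w) \<in> parcs T \<Longrightarrow> w \<in> pverts T \<Longrightarrow> w \<noteq> y \<Longrightarrow> w \<in> branch T y z"
  by (auto simp: branch_def intro: rtrancl_on_into_rtrancl_on)

text \<open>A path from \<open>z\<close> to \<open>x\<close> avoiding \<open>y\<close> would close
  up through \<open>y\<close> to a cycle. Here the acyclicity of \<open>T\<close> enters the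
  separator argument.\<close>

lemma other_neighbour_notin_branch:
  assumes T: "undirected_tree T" and yx: "(y, x) \<in> parcs T" and yz: "(y, z) \<in> parcs T"
    and "x \<noteq> z"
  shows "x \<notin> branch T y z"
proof
  assume x: "x \<in> branch T y z"
  interpret pair_graph T using T by (simp add: undirected_tree_def)
  let ?H = "with_proj T \<restriction> (pverts T - {y})"
  interpret H: wf_digraph ?H by (rule wellformed_induce_subgraph)
  have ends: "arcs_ends ?H = parcs T \<inter> (pverts T - {y}) \<times> (pverts T - {y})"
    by (auto simp: arcs_ends_conv image_def)
  have "(z, x) \<in> rtrancl_on (pverts T - {y}) (parcs T)"
    using x by (simp add: branch_def)
  then have "(z, x) \<in> rtrancl_on (pverts T - {y}) (arcs_ends ?H)"
    unfolding ends by (induct rule: rtrancl_on_induct) (auto intro: rtrancl_on_into_rtrancl_on)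
  then have "z \<rightarrow>\<^sup>*\<^bsub>?H\<^esub> x" by (simp add: reachable_def)
  then obtain p where p: "H.apath z p x" using H.reachable_apath by blast
  \<comment> \<open>Walks and their vertex lists depend only on the tail and head functions, which
    the induced subgraph shares with \<open>T\<close>; so \<open>p\<close> is also a walk of
    \<open>T\<close>.\<close>
  have compat: "compatible (with_proj T) ?H" by (auto simp: compatible_def)
  have cas: "pre_digraph.cas ?H = pcas"
    using compatible_cas[OF compat] cas_with_proj_eq by metis
  have vs: "pre_digraph.awalk_verts ?H = pawalk_verts"
    using compatible_awalk_verts[OF compat] awalk_verts_with_proj_eq by metis
  have "p \<noteq> []" using p \<open>x \<noteq> z\<close> by (auto simp: H.apath_Nil_iff)
  have w: "H.awalk z p x" using p by (rule H.awalkI_apath)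
  have pv: "set (pawalk_verts z p) \<subseteq> pverts T - {y}" and d: "distinct (pawalk_verts z p)"
    and cp: "pcas z p x"
    using w p unfolding H.awalk_conv H.apath_def vs cas by auto
  have pa: "set p \<subseteq> parcs T" using w by (auto simp: H.awalk_def)
  have zv: "z \<in> pverts T" using yz by (rule in_arcsD2)
  have wp: "awalk z p x" using pa cp zv by (simp add: awalk_def)
  have xy: "(x, y) \<in> parcs T" using yx by (rule arcs_symmetric)
  have wc: "awalk y ((y, z) # p @ [(x, y)]) y"
    using wp yz xy by (simp add: awalk_simps awlast_of_awalk in_arcsD2[OF xy])
  have vv: "tl (pawalk_verts y ((y, z) # p @ [(x, y)])) = pawalk_verts z p @ [y]"
    using awalk_verts_append[of z p "[(x,y)]" y] wp xy in_arcsD2[OF xy]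
    by (simp add: awalk_simps)
  have "cycle ((y, z) # p @ [(x, y)])"
    unfolding cycle_def
  proof (intro exI conjI)
    show "awalk y ((y, z) # p @ [(x, y)]) y" by (rule wc)
    show "distinct (tl (pawalk_verts y ((y, z) # p @ [(x, y)])))"
      unfolding vv using d pv by auto
  qed simp
  moreover have "length ((y, z) # p @ [(x, y)]) \<ge> 3"
    using \<open>p \<noteq> []\<close> by (cases p) auto
  ultimately show False using T unfolding undirected_tree_def by blast
qed

text \<open>A walk from \<open>z\<close> avoiding \<open>y\<close> cannot meet \<open>x\<close>, by
  the preceding lemma, so it stays in \<open>T - x\<close>. The node \<open>y\<close> itself makes
  the inclusion strict, so that branches shrink on the way outwards.\<close>

lemma branch_psubset:
  assumes T: "undirected_tree T" and xy: "(x, y) \<in> parcs T" and yz: "(y, z) \<in> parcs T" and "z \<noteq> x"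
  shows "branch T y z \<subset> branch T x y"
proof -
  interpret pair_graph T using T by (simp add: undirected_tree_def)
  have x: "x \<notin> branch T y z"
    using other_neighbour_notin_branch[OF T arcs_symmetric[OF xy] yz] \<open>z \<noteq> x\<close> by blast
  have "x \<noteq> y" using xy pair_no_loops by fastforce
  then have y: "y \<in> branch T x y" using in_arcsD2[OF xy] by (auto simp: branch_def)
  have "w \<in> branch T x y" if "(z, w) \<in> rtrancl_on (pverts T - {y}) (parcs T)" for w
    using that
  proof (induct rule: rtrancl_on_induct)
    case base
    then show ?case using branch_closed[OF y yz] \<open>z \<noteq> x\<close> by blast
  next
    case (step u w)
    have "w \<in> branch T y z"
      using step by (auto simp: branch_def intro: rtrancl_on_into_rtrancl_on)
    then show ?case using branch_closed[OF step(5) step(2)] step(4) x by blast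
  qed
  then have "branch T y z \<subseteq> branch T x y" by (auto simp: branch_def)
  moreover have "y \<notin> branch T y z" using branch_subset by fast
  ultimately show ?thesis using y by blast
qed

text \<open>Follow a walk from \<open>y\<close>: whenever it leaves \<open>y\<close> it enters a
  branch beyond \<open>y\<close>, and it stays there until it returns to \<open>y\<close>.\<close>

lemma branch_decompose:
  assumes T: "undirected_tree T" and xy: "(x, y) \<in> parcs T"
  shows "branch T x y \<subseteq> insert y (\<Union>z\<in>neighbours T y - {x}. branch T y z)"
proof -
  interpret pair_graph T using T by (simp add: undirected_tree_def)
  have "w \<in> insert y (\<Union>z\<in>neighbours T y - {x}. branch T y z)"
    if "(y, w) \<in> rtrancl_on (pverts T - {x}) (parcs T)" for w
    using that
  proof (induct rule: rtrancl_on_induct)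
    case (step u w)
    show ?case
    proof (cases "w = y")
      case False
      show ?thesis
      proof (cases "u = y")
        case True
        have "w \<in> branch T y w" using step(4) False by (auto simp: branch_def)
        then show ?thesis using step(2,4) True by auto
      next
        case False
        then obtain z where "z \<in> neighbours T y - {x}" "u \<in> branch T y z" using step(5) by blast
        then show ?thesis using branch_closed[OF _ step(2)] step(4) \<open>w \<noteq> y\<close> by blast
      qed
    qed simp
  qed simp
  then show ?thesis by (auto simp: branch_def)
qed

lemma tree_decompose:
  assumes T: "undirected_tree T" and y: "y \<in> pverts T"
  shows "pverts T \<subseteq> insert y (\<Union>z\<in>neighbours T y. branch T y z)"
proof
  interpret pair_graph T using T by (simp add: undirected_tree_def)
  fix w assume "w \<in> pverts T"
  then have "(y, w) \<in> rtrancl_on (pverts T) (parcs T)"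
    using T y connected_with_proj_iff[OF sym_parcs[of T]] by (auto simp: undirected_tree_def)
  then show "w \<in> insert y (\<Union>z\<in>neighbours T y. branch T y z)"
  proof (induct rule: rtrancl_on_induct)
    case (step u w)
    show ?case
    proof (cases "w = y")
      case False
      show ?thesis
      proof (cases "u = y")
        case True
        have "w \<in> branch T y w" using step(4) False by (auto simp: branch_def)
        then show ?thesis using step(2,4) True by auto
      next
        case False
        then obtain z where "z \<in> neighbours T y" "u \<in> branch T y z" using step(5) by blast
        then show ?thesis using branch_closed[OF _ step(2)] step(4) \<open>w \<noteq> y\<close> by blast
      qed
    qed simp
  qed simp
qed

text \<open>Take an arc \<open>(x, y)\<close> whose branch is heavy and has the fewest nodes. The
  branches at \<open>y\<close> away from \<open>x\<close> are strictly smaller, hence light, and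
  together with \<open>y\<close> they cover it. If no branch is heavy, any node with all its
  branches will do.\<close>

lemma exists_deepest_heavy_node:
  fixes W :: "'b set \<Rightarrow> nat"
  assumes T: "undirected_tree T" and heavy: "q \<le> W (pverts T)" and W: "mono W"
  obtains y Z where "y \<in> pverts T" "Z \<subseteq> neighbours T y"
    "q \<le> W (insert y (\<Union>z\<in>Z. branch T y z))" "\<And>z. z \<in> Z \<Longrightarrow> W (branch T y z) < q"
proof -
  interpret pair_graph T using T by (simp add: undirected_tree_def)
  show ?thesis
  proof (cases "\<exists>(x, y)\<in>parcs T. q \<le> W (branch T x y)")
    case True
    define P where "P = (\<lambda>e. e \<in> parcs T \<and> q \<le> W (branch T (fst e) (snd e)))"
    have "\<exists>e. P e" using True by (auto simp: P_def)
    then obtain e where e: "P e"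
      and least: "\<And>e'. P e' \<Longrightarrow> card (branch T (fst e) (snd e)) \<le> card (branch T (fst e') (snd e'))"
      using ex_has_least_nat[of P _ "\<lambda>e. card (branch T (fst e) (snd e))"] by blast
    obtain x y where xy: "e = (x, y)" by (cases e)
    have arc: "(x, y) \<in> parcs T" and q: "q \<le> W (branch T x y)" using e xy by (auto simp: P_def)
    show ?thesis
    proof (rule that[of y "neighbours T y - {x}"])
      show "y \<in> pverts T" using arc by (rule in_arcsD2)
      show "q \<le> W (insert y (\<Union>z\<in>neighbours T y - {x}. branch T y z))"
        using q monoD[OF W branch_decompose[OF T arc]] by linarith
      fix z assume z: "z \<in> neighbours T y - {x}"
      have "finite (branch T x y)"
        using pair_finite_verts branch_subset[of T x y] by (meson Diff_subset finite_subset subset_trans)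
      then have "card (branch T y z) < card (branch T x y)"
        using branch_psubset[OF T arc, of z] z by (intro psubset_card_mono) auto
      then show "W (branch T y z) < q"
        using least[of "(y, z)"] z xy by (force simp: P_def)
    qed auto
  next
    case False
    obtain y where y: "y \<in> pverts T"
      using T connected_with_proj_iff[OF sym_parcs[of T]] by (auto simp: undirected_tree_def)
    show ?thesis
    proof (rule that[of y "neighbours T y"])
      show "q \<le> W (insert y (\<Union>z\<in>neighbours T y. branch T y z))"
        using heavy monoD[OF W tree_decompose[OF T y]] by linarith
      show "W (branch T y z) < q" if "z \<in> neighbours T y" for z
        using False that by force
    qed (use y in auto)
  qed
qed

text \<open>The nodes whose bags contain \<open>v\<close> form a connected set avoiding
  \<open>y\<close>, so this set lies in a single branch. It includes a node whose bag contains both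
  \<open>v\<close> and \<open>w\<close>.\<close>

lemma bag_separates:
  assumes dec: "tree_decomposition G T B" and Z: "Z \<subseteq> neighbours T y"
    and v: "v \<in> (\<Union>z\<in>Z. \<Union>(B ` branch T y z)) - B y" and vw: "(v, w) \<in> parcs G"
    and G: "pair_graph G"
  shows "w \<in> (\<Union>z\<in>Z. \<Union>(B ` branch T y z)) \<union> B y"
proof -
  have T: "undirected_tree T" and bags: "tree_bags G T B"
    using dec by (auto simp: tree_decomposition_def tree_bags_def)
  interpret T: pair_graph T using T by (simp add: undirected_tree_def)
  interpret G: pair_graph G by fact
  have "v \<in> pverts G" using vw by (rule G.in_arcsD1)
  then have "Digraph_Component.connected (with_proj T \<restriction> bag_nodes T B v)"
    using bags by (auto simp: tree_bags_def)
  then have conn: "\<And>a b. a \<in> bag_nodes T B v \<Longrightarrow> b \<in> bag_nodes T B v \<Longrightarrow>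
      (a, b) \<in> rtrancl_on (bag_nodes T B v) (parcs T)"
    using connected_induce_iff[OF sym_parcs[OF T.pair_graph]] by blast
  obtain n where n: "n \<in> pverts T" "v \<in> B n" "w \<in> B n"
    using dec vw by (fastforce simp: tree_decomposition_def)
  obtain z a where z: "z \<in> Z" and a: "a \<in> branch T y z" "v \<in> B a" using v by blast
  have "a \<in> bag_nodes T B v" "n \<in> bag_nodes T B v"
    using a n branch_subset[of T y z] by (auto simp: bag_nodes_def)
  then have "(a, n) \<in> rtrancl_on (bag_nodes T B v) (parcs T)" by (rule conn)
  then have "n \<in> branch T y z"
  proof (induct rule: rtrancl_on_induct)
    case base
    show ?case by (rule a(1))
  next
    case (step b c)
    have "c \<in> pverts T" "v \<in> B c" using step(4) by (auto simp: bag_nodes_def)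
    then show ?case using branch_closed[OF step(5,2)] v by blast
  qed
  then show ?thesis using z n by blast
qed

text \<open>Weigh a set of nodes by the number of vertices of \<open>S\<close> in its bags, and take
  a deepest node \<open>y\<close> of weight at least \<open>4 * k\<close>. A minimal family of its
  light branches that reaches \<open>4 * k\<close> together with the separator \<open>I\<close>
  stays within \<open>8 * k\<close>, so more than \<open>12 * k - 8 * k\<close> vertices of
  \<open>S\<close> are left for \<open>C\<close>.\<close>

lemma separation_of_large_set:
  assumes dec: "tree_decomposition G T B" and G: "pair_graph G"
    and bags: "\<And>x. x \<in> pverts T \<Longrightarrow> card (B x) \<le> k"
    and SU: "S \<subseteq> U" and UG: "U \<subseteq> pverts G" and large: "12 * k < card S"
  obtains A I C where "U = A \<union> I \<union> C" "A \<inter> I = {}" "A \<inter> C = {}" "I \<inter> C = {}"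
    "card I \<le> k" "4 * k \<le> card (S \<inter> A) + card I" "4 * k \<le> card (S \<inter> C)"
    "\<And>v w. v \<in> A \<Longrightarrow> w \<in> C \<Longrightarrow> (v, w) \<notin> parcs G"
proof -
  interpret G: pair_graph G by fact
  have T: "undirected_tree T" and tb: "tree_bags G T B"
    using dec by (auto simp: tree_decomposition_def tree_bags_def)
  interpret T: pair_graph T using T by (simp add: undirected_tree_def)
  have fU: "finite U" using UG G.pair_finite_verts by (rule finite_subset)
  then have fS: "finite S" using SU finite_subset by blast
  define W where "W = (\<lambda>X. card (S \<inter> \<Union>(B ` X)))"
  have "mono W" unfolding W_def by (intro monoI card_mono) (use fS in auto)
  have "v \<in> \<Union>(B ` pverts T)" if "v \<in> S" for v
  proof -
    have "Digraph_Component.connected (with_proj T \<restriction> bag_nodes T B v)"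
      using tb that SU UG by (auto simp: tree_bags_def)
    then have "bag_nodes T B v \<noteq> {}" by (simp add: connected_conv)
    then show ?thesis by (auto simp: bag_nodes_def)
  qed
  then have "S \<inter> \<Union>(B ` pverts T) = S" by blast
  then have "4 * k \<le> W (pverts T)" using large by (simp add: W_def)
  then obtain y Z where y: "y \<in> pverts T" and Z: "Z \<subseteq> neighbours T y"
    and heavy: "4 * k \<le> W (insert y (\<Union>z\<in>Z. branch T y z))"
    and light: "\<And>z. z \<in> Z \<Longrightarrow> W (branch T y z) < 4 * k"
    using exists_deepest_heavy_node[OF T _ \<open>mono W\<close>] by blast
  define I where "I = B y \<inter> U"
  define A where "A = (\<lambda>Q. ((\<Union>z\<in>Q. \<Union>(B ` branch T y z)) - B y) \<inter> U)"
  have "B y \<subseteq> pverts G" using tb y by (auto simp: tree_bags_def)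
  then have "finite (B y)" using G.pair_finite_verts finite_subset by blast
  then have I: "card I \<le> k" unfolding I_def
    using bags[OF y] card_mono[of "B y" "B y \<inter> U"] by auto
  \<comment> \<open>The separator is counted in full, and not only its part in \<open>S\<close>,
    because all of \<open>I\<close> will join the prescribed root set on either side.\<close>
  define P where "P = (\<lambda>Q. Q \<subseteq> Z \<and> 4 * k \<le> card (S \<inter> A Q) + card I)"
  have fI: "finite I" using fU by (simp add: I_def)
  have "S \<inter> \<Union>(B ` insert y (\<Union>z\<in>Z. branch T y z)) \<subseteq> (S \<inter> A Z) \<union> I"
    using SU by (auto simp: A_def I_def)
  then have "W (insert y (\<Union>z\<in>Z. branch T y z)) \<le> card ((S \<inter> A Z) \<union> I)"
    unfolding W_def by (intro card_mono) (use fS fI in auto)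
  also have "\<dots> \<le> card (S \<inter> A Z) + card I" by (rule card_Un_le)
  finally have "P Z" using heavy by (simp add: P_def)
  then obtain Q where Q: "P Q" and least: "\<And>Q'. P Q' \<Longrightarrow> card Q \<le> card Q'"
    using ex_has_least_nat[of P Z card] by blast
  have "neighbours T y \<subseteq> pverts T" using T.in_arcsD2 by auto
  then have fQ: "finite Q" using Q Z T.pair_finite_verts by (meson P_def finite_subset)
  have upper: "card (S \<inter> A Q) + card I \<le> 8 * k"
  proof (cases "Q = {}")
    case True
    then have "card (S \<inter> A Q) = 0" by (simp add: A_def)
    then show ?thesis using I by linarith
  next
    case False
    then obtain z where z: "z \<in> Q" by blast
    \<comment> \<open>By minimality the family without \<open>z\<close> stays below
      \<open>4 * k\<close>, and the light branch at \<open>z\<close> adds less than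
      \<open>4 * k\<close>.\<close>
    have "\<not> P (Q - {z})" using least[of "Q - {z}"] fQ z
      by (metis card_Diff1_less linorder_not_le)
    then have 1: "card (S \<inter> A (Q - {z})) + card I < 4 * k" using Q by (auto simp: P_def)
    have "S \<inter> A Q \<subseteq> (S \<inter> A (Q - {z})) \<union> (S \<inter> \<Union>(B ` branch T y z))"
      by (auto simp: A_def)
    then have "card (S \<inter> A Q) \<le> card ((S \<inter> A (Q - {z})) \<union> (S \<inter> \<Union>(B ` branch T y z)))"
      by (intro card_mono) (use fS in auto)
    also have "\<dots> \<le> card (S \<inter> A (Q - {z})) + W (branch T y z)"
      unfolding W_def by (rule card_Un_le)
    finally show ?thesis using 1 light[of z] z Q by (force simp: P_def)
  qed
  define C where "C = U - A Q - I"
  have "S \<subseteq> (S \<inter> A Q) \<union> (S \<inter> C) \<union> I" using SU by (auto simp: C_def)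
  then have "card S \<le> card ((S \<inter> A Q) \<union> (S \<inter> C) \<union> I)"
    by (intro card_mono) (use fS fI in auto)
  also have "\<dots> \<le> card (S \<inter> A Q) + card (S \<inter> C) + card I"
    by (meson add_le_mono card_Un_le le_trans order_refl)
  finally have low: "4 * k \<le> card (S \<inter> C)" using large upper by linarith
  show ?thesis
  proof (rule that[of "A Q" I C])
    show "(v, w) \<notin> parcs G" if "v \<in> A Q" "w \<in> C" for v w
    proof
      assume vw: "(v, w) \<in> parcs G"
      have "w \<in> (\<Union>z\<in>Q. \<Union>(B ` branch T y z)) \<union> B y"
        using bag_separates[OF dec _ _ vw G, of Q y] Q Z that(1) by (auto simp: P_def A_def)
      then show False using that(2) by (auto simp: C_def A_def I_def)
    qed
  qed (use I low Q in \<open>auto simp: P_def C_def A_def I_def\<close>)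
qed

section \<open>Trees given by a parent function\<close>

text \<open>Both orientations of every edge are arcs. Excluding the root keeps values such as
  \<open>tl [] = []\<close> from producing a loop.\<close>

definition parent_graph :: "'b set \<Rightarrow> 'b \<Rightarrow> ('b \<Rightarrow> 'b) \<Rightarrow> 'b pair_pre_digraph" where
  "parent_graph X r par =
    \<lparr> pverts = X, parcs = {(x, y) \<in> X \<times> X. x \<noteq> r \<and> y = par x \<or> y \<noteq> r \<and> x = par y} \<rparr>"

lemma pcas_nth:
  "pcas u p v \<Longrightarrow> i < length p \<Longrightarrow> snd (p ! i) = (if Suc i < length p then fst (p ! Suc i) else v)"
proof (induct p arbitrary: u i)
  case (Cons e p)
  then show ?case
    by (cases i; cases p) auto
qed simp

text \<open>The level decreases towards the root, so iterated parents end at \<open>r\<close>; this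
  gives connectedness, and a maximal level on a cycle gives acyclicity.\<close>

locale parent_tree =
  fixes X :: "'b set" and r :: 'b and par :: "'b \<Rightarrow> 'b" and lev :: "'b \<Rightarrow> nat"
  assumes finite_nodes: "finite X" and root_in: "r \<in> X"
    and par_in: "x \<in> X \<Longrightarrow> x \<noteq> r \<Longrightarrow> par x \<in> X"
    and lev_par: "x \<in> X \<Longrightarrow> x \<noteq> r \<Longrightarrow> lev (par x) < lev x"
begin

abbreviation "T \<equiv> parent_graph X r par"

lemma pverts_T[simp]: "pverts T = X"
  by (simp add: parent_graph_def)

lemma parcs_T: "(x, y) \<in> parcs T \<longleftrightarrow> x \<in> X \<and> y \<in> X \<and> (x \<noteq> r \<and> y = par x \<or> y \<noteq> r \<and> x = par y)"
  by (simp add: parent_graph_def)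

lemma sym_T: "sym (parcs T)"
  by (auto simp: parcs_T intro: symI)

lemma pair_graph_T: "pair_graph T"
proof
  show "finite (parcs T)"
    by (rule finite_subset[of _ "X \<times> X"]) (auto simp: parent_graph_def finite_nodes)
  show "symmetric (with_proj T)"
    using sym_T by (simp add: symmetric_def)
  show "fst e \<noteq> snd e" if "e \<in> parcs T" for e
    using that lev_par by (cases e) (force simp: parcs_T)
qed (auto simp: finite_nodes parcs_T)

text \<open>Every node of \<open>Y\<close> climbs through parents inside \<open>Y\<close> to the top
  node \<open>t\<close>, and symmetry of the arcs gives the way back down.\<close>

lemma reachable_in_closed_set:
  assumes YX: "Y \<subseteq> X" and t: "t \<in> Y"
    and closed: "\<And>x. x \<in> Y \<Longrightarrow> x \<noteq> t \<Longrightarrow> x \<noteq> r \<and> par x \<in> Y"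
    and u: "u \<in> Y" and v: "v \<in> Y"
  shows "(u, v) \<in> rtrancl_on Y (parcs T)"
proof -
  have up: "(x, t) \<in> rtrancl_on Y (parcs T)" if "x \<in> Y" for x
    using that
  proof (induct "lev x" arbitrary: x rule: less_induct)
    case less
    show ?case
    proof (cases "x = t")
      case False
      then have "x \<noteq> r" "par x \<in> Y" using closed less by auto
      then show ?thesis
        using less YX lev_par par_in
        by (intro converse_rtrancl_on_into_rtrancl_on[of x "par x"]) (auto simp: parcs_T)
    qed (use t in simp)
  qed
  have "(t, v) \<in> rtrancl_on Y (parcs T)"
    using rtrancl_on_sym[OF sym_T] up[OF v] by (rule symD)
  with up[OF u] show ?thesis by (rule rtrancl_on_trans)
qed

lemma connected_closed_set:
  assumes "Y \<subseteq> X" "t \<in> Y" "\<And>x. x \<in> Y \<Longrightarrow> x \<noteq> t \<Longrightarrow> x \<noteq> r \<and> par x \<in> Y"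
  shows "Digraph_Component.connected (with_proj T \<restriction> Y)"
  unfolding connected_induce_iff[OF sym_T] using reachable_in_closed_set[OF assms] assms(2) by blast

text \<open>At a node of maximal level on a cycle, both neighbours on the cycle must be its parent,
  so they coincide. This is impossible on a cycle of length at least 3.\<close>

lemma no_cycle:
  assumes cyc: "pre_digraph.cycle (with_proj T) p"
  shows "length p < 3"
proof (rule ccontr)
  assume len: "\<not> length p < 3"
  interpret pair_graph T by (rule pair_graph_T)
  define n where "n = length p"
  have n: "3 \<le> n" using len by (simp add: n_def)
  obtain u where w: "awalk u p u" and d: "distinct (tl (pawalk_verts u p))"
    using cyc by (auto simp: cycle_def)
  have "pawalk_verts u p = u # map snd p"
    using awalk_verts_conv'[of u p u] w len by (cases p) (auto simp: awalk_def)
  then have d: "distinct (map snd p)" using d by simp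
  have arcs: "set p \<subseteq> parcs T" using w by (simp add: awalk_def)
  have cas: "pcas u p u" using w by (simp add: awalk_def)
  define nxt where "nxt = (\<lambda>i. if Suc i < n then Suc i else 0)"
  have "fst (p ! 0) = u" using cas n by (cases p) (auto simp: n_def)
  then have step: "snd (p ! i) = fst (p ! nxt i)" if "i < n" for i
    using pcas_nth[OF cas, of i] that by (simp add: nxt_def n_def)
  let ?L = "(\<lambda>j. lev (snd (p ! j))) ` {..<n}"
  have "?L \<noteq> {}" using n by (auto simp: lessThan_empty_iff)
  then have "Max ?L \<in> ?L" by (intro Max_in) auto
  then obtain i where i: "i < n" and max: "lev (snd (p ! i)) = Max ?L" by auto
  have top: "lev (snd (p ! j)) \<le> lev (snd (p ! i))" if "j < n" for j
    unfolding max using that by (intro Max_ge) auto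
  \<comment> \<open>\<open>j\<close> is the cyclic predecessor of \<open>i\<close>; with at least
    three arcs it differs from the cyclic successor \<open>nxt i\<close>.\<close>
  define j where "j = (if i = 0 then n - 1 else i - 1)"
  have j: "j < n" "nxt j = i" "nxt i < n" "j \<noteq> nxt i" using i n by (auto simp: j_def nxt_def)
  let ?m = "snd (p ! i)"
  have "(snd (p ! j), ?m) \<in> parcs T"
    using step[OF j(1)] arcs i j by (metis n_def nth_mem prod.collapse subset_iff)
  moreover have "(?m, snd (p ! nxt i)) \<in> parcs T"
    using step[OF i] arcs j by (metis n_def nth_mem prod.collapse subset_iff)
  ultimately have "snd (p ! j) = snd (p ! nxt i)"
    using top[OF j(1)] top[OF j(3)] lev_par[of "snd (p ! j)"] lev_par[of "snd (p ! nxt i)"]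
    by (auto simp: parcs_T)
  then show False
    using d j by (metis distinct_conv_nth length_map n_def nth_map)
qed

lemma undirected_tree_T: "undirected_tree T"
proof -
  have "Digraph_Component.connected (with_proj T)"
    unfolding connected_with_proj_iff[OF sym_T]
    using reachable_in_closed_set[of X r] root_in par_in by auto
  then show ?thesis
    unfolding undirected_tree_def using pair_graph_T no_cycle by (meson not_le)
qed

text \<open>Induction along the path from the root: if the last arc led upwards from
  \<open>x\<close>, it would return to the predecessor of \<open>x\<close>, which by induction is
  \<open>par x\<close>, and the path would repeat a vertex.\<close>

lemma is_parent_T:
  assumes "is_parent T r x y"
  shows "y \<in> X \<and> y \<noteq> r \<and> x = par y"
proof -
  interpret pair_graph T by (rule pair_graph_T)
  have "y \<in> X \<and> y \<noteq> r \<and> x = par y" if "apath r (p @ [(x, y)]) y" for p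
    using that
  proof (induct p arbitrary: x y rule: rev_induct)
    case Nil
    then show ?case by (auto simp: apath_def awalk_simps parcs_T)
  next
    case (snoc e p)
    obtain w x' where e: "e = (w, x')" by (cases e)
    have 1: "apath r (p @ [(w, x')]) (awlast r (p @ [(w, x')]))"
      and 2: "apath (awlast r (p @ [(w, x')])) [(x, y)] y"
      and 3: "set (pawalk_verts r (p @ [(w, x')])) \<inter> {y} = {}"
      using snoc(2) unfolding e apath_append_iff[of r "p @ [(w, x')]"] by auto
    have "awlast r (p @ [(w, x')]) = x'" by (simp add: awalk_verts_conv)
    then have "x = x'" "(x, y) \<in> parcs T" and p: "apath r (p @ [(w, x)]) x"
      using 1 2 by (auto simp: apath_simps)
    moreover have "w \<noteq> y" using 3 by (auto simp: awalk_verts_conv)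
    moreover have "x \<noteq> r \<and> w = par x" using snoc(1)[OF p] by simp
    ultimately show ?case by (auto simp: parcs_T)
  qed
  then show ?thesis using assms by (auto simp: is_parent_def)
qed

lemma degree_T_le:
  "degree T x \<le> card {y \<in> X. y \<noteq> r \<and> par y = x} + (if x = r then 0 else 1)"
proof -
  let ?C = "{y \<in> X. y \<noteq> r \<and> par y = x}" and ?P = "if x = r then {} else {par x}"
  have fin: "finite (?C \<union> ?P)" using finite_nodes by simp
  have "out_arcs (with_proj T) x \<subseteq> Pair x ` (?C \<union> ?P)"
    by (auto simp: out_arcs_def parent_graph_def)
  then have "degree T x \<le> card (Pair x ` (?C \<union> ?P))"
    unfolding out_degree_def using fin by (intro card_mono) auto
  also have "\<dots> \<le> card (?C \<union> ?P)" using fin by (rule card_image_le)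
  also have "\<dots> \<le> card ?C + card ?P" by (rule card_Un_le)
  finally show ?thesis by (simp split: if_splits)
qed

end

section \<open>Decompositions indexed by lists\<close>

text \<open>Rooted trees are encoded as finite sets of lists that contain the empty list, the root, and
  are closed under \<^const>\<open>tl\<close>, which is the parent function.\<close>

definition list_tree :: "nat list set \<Rightarrow> bool" where
  "list_tree X \<longleftrightarrow> finite X \<and> [] \<in> X \<and> (\<forall>x\<in>X. tl x \<in> X)"

definition children :: "nat list set \<Rightarrow> nat list \<Rightarrow> nat list set" where
  "children X x = {y \<in> X. y \<noteq> [] \<and> tl y = x}"

text \<open>As \<open>tl [] = []\<close>, the edge condition at the root says that both ends lie in the root bag.
  The node \<open>t\<close> is the topmost one whose bag contains \<open>v\<close>.\<close>

definition slick_decomposition ::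
    "nat \<Rightarrow> 'a pair_pre_digraph \<Rightarrow> 'a set \<Rightarrow> nat list set \<Rightarrow> (nat list \<Rightarrow> 'a set) \<Rightarrow> bool" where
  "slick_decomposition s G U X B \<longleftrightarrow> list_tree X \<and> (\<forall>x\<in>X. B x \<subseteq> U) \<and>
     (\<forall>v\<in>U. \<exists>t\<in>X. v \<in> B t \<and> (\<forall>x\<in>X. v \<in> B x \<longrightarrow> x = t \<or> x \<noteq> [] \<and> v \<in> B (tl x))) \<and>
     (\<forall>v\<in>U. \<forall>w\<in>U. (v, w) \<in> parcs G \<longrightarrow> (\<exists>x\<in>X. v \<in> B x \<union> B (tl x) \<and> w \<in> B x \<union> B (tl x))) \<and>
     (\<forall>x\<in>X. x \<noteq> [] \<longrightarrow> (\<forall>v\<in>B x \<inter> B (tl x). s \<le> card ((neighbours G v \<inter> B x) - B (tl x))))"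

lemma slick_decompositionD:
  assumes "slick_decomposition s G U X B"
  shows "list_tree X" "x \<in> X \<Longrightarrow> B x \<subseteq> U"
    "v \<in> U \<Longrightarrow> \<exists>t\<in>X. v \<in> B t \<and> (\<forall>x\<in>X. v \<in> B x \<longrightarrow> x = t \<or> x \<noteq> [] \<and> v \<in> B (tl x))"
    "v \<in> U \<Longrightarrow> w \<in> U \<Longrightarrow> (v, w) \<in> parcs G \<Longrightarrow> \<exists>x\<in>X. v \<in> B x \<union> B (tl x) \<and> w \<in> B x \<union> B (tl x)"
    "x \<in> X \<Longrightarrow> x \<noteq> [] \<Longrightarrow> v \<in> B x \<Longrightarrow> v \<in> B (tl x) \<Longrightarrow> s \<le> card ((neighbours G v \<inter> B x) - B (tl x))"
  using assms unfolding slick_decomposition_def by blast+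

lemma list_treeD:
  assumes "list_tree X"
  shows "finite X" "[] \<in> X" "x \<in> X \<Longrightarrow> tl x \<in> X"
  using assms by (auto simp: list_tree_def)

text \<open>Slickness bounds the spread: each node containing \<open>v\<close>, except the topmost one, contributes
  \<open>s\<close> neighbours of \<open>v\<close> that have this node as their topmost node.\<close>

lemma slick_decomposition_spread:
  assumes dec: "slick_decomposition s G (pverts G) X B" and G: "pair_graph G" and v: "v \<in> pverts G"
  shows "(card {x \<in> X. v \<in> B x} - 1) * s \<le> degree G v"
proof -
  interpret pair_graph G by fact
  note D = slick_decompositionD[OF dec]
  obtain t where t: "t \<in> X" "v \<in> B t" "\<And>x. x \<in> X \<Longrightarrow> v \<in> B x \<Longrightarrow> x = t \<or> x \<noteq> [] \<and> v \<in> B (tl x)"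
    using D(3)[OF v] by blast
  let ?Y = "{x \<in> X. v \<in> B x} - {t}"
  let ?N = "\<lambda>x. (neighbours G v \<inter> B x) - B (tl x)"
  have fN: "finite (neighbours G v)"
    by (rule finite_subset[OF _ pair_finite_verts]) (auto intro: in_arcsD2)
  have fY: "finite ?Y" using list_treeD(1)[OF D(1)] by simp
  \<comment> \<open>A vertex of \<open>?N x\<close> lies in the bag of \<open>x\<close> but not in
    that of its parent, so \<open>x\<close> is its topmost node.\<close>
  have disj: "?N x \<inter> ?N y = {}" if "x \<in> ?Y" "y \<in> ?Y" "x \<noteq> y" for x y
  proof -
    have "x = y" if "w \<in> ?N x" "w \<in> ?N y" for w
    proof -
      have "w \<in> pverts G" using that in_arcsD2 by auto
      then show ?thesis using D(3)[of w] that \<open>x \<in> ?Y\<close> \<open>y \<in> ?Y\<close> by blast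
    qed
    then show ?thesis using that(3) by blast
  qed
  have "card ?Y * s = (\<Sum>x\<in>?Y. s)" by simp
  also have "\<dots> \<le> (\<Sum>x\<in>?Y. card (?N x))"
    using t D(5) by (intro sum_mono) auto
  also have "\<dots> = card (\<Union>x\<in>?Y. ?N x)"
    using fY fN disj by (intro card_UN_disjoint[symmetric]) auto
  also have "\<dots> \<le> card (neighbours G v)" using fN by (intro card_mono) auto
  also have "\<dots> = card (Pair v ` neighbours G v)" by (simp add: card_image inj_on_def)
  also have "Pair v ` neighbours G v = out_arcs (with_proj G) v" by (auto simp: out_arcs_def)
  finally have "card ?Y * s \<le> degree G v" by (simp add: out_degree_def)
  moreover have "card ?Y = card {x \<in> X. v \<in> B x} - 1"
    using t(1,2) by (simp add: card_Diff_singleton)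
  ultimately show ?thesis by simp
qed

text \<open>The list tree is moved to natural numbers by \<open>to_nat\<close>. The bags of a vertex
  are connected because all of them climb to its topmost node; \<open>m\<close> counts the children,
  and the parent at every node but the root.\<close>

lemma slick_decomposition_realize:
  assumes dec: "slick_decomposition s G (pverts G) X B" and G: "pair_graph G"
    and deg: "\<And>x. x \<in> X \<Longrightarrow> card (children X x) + (if x = [] then 0 else 1) \<le> m"
  obtains T :: "nat pair_pre_digraph" and r B' where
    "weak_tree_decomposition G T B'" "r \<in> pverts T" "slick s G T r B'"
    "card (pverts T) = card X" "B' ` pverts T = B ` X"
    "max_degree T \<le> m" "\<forall>v. spread T B' v = card {x \<in> X. v \<in> B x}"
proof -
  interpret G: pair_graph G by fact
  note D = slick_decompositionD[OF dec]
  note X = list_treeD[OF D(1)]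
  let ?e = "to_nat :: nat list \<Rightarrow> nat" and ?d = "from_nat :: nat \<Rightarrow> nat list"
  have inj: "inj_on ?e Y" for Y by (meson inj_on_subset inj_to_nat top_greatest)
  define par where "par = (\<lambda>n. ?e (tl (?d n)))"
  define B' where "B' = (\<lambda>n. B (?d n))"
  interpret P: parent_tree "?e ` X" "?e []" par "\<lambda>n. length (?d n)"
    using X by unfold_locales (auto simp: par_def)
  have nodes: "bag_nodes P.T B' v = ?e ` {x \<in> X. v \<in> B x}" for v
    by (auto simp: bag_nodes_def B'_def)
  have bags: "tree_bags G P.T B'"
    unfolding tree_bags_def
  proof (intro conjI ballI)
    show "undirected_tree P.T" by (rule P.undirected_tree_T)
    show "B' x \<subseteq> pverts G" if "x \<in> pverts P.T" for x
      using that D(2) by (fastforce simp: B'_def)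
    fix v assume "v \<in> pverts G"
    then obtain t where t: "t \<in> X" "v \<in> B t"
      "\<And>x. x \<in> X \<Longrightarrow> v \<in> B x \<Longrightarrow> x = t \<or> x \<noteq> [] \<and> v \<in> B (tl x)"
      using D(3) by blast
    show "Digraph_Component.connected (with_proj P.T \<restriction> bag_nodes P.T B' v)"
      unfolding nodes
    proof (rule P.connected_closed_set[of _ "?e t"])
      fix x assume "x \<in> ?e ` {x \<in> X. v \<in> B x}" "x \<noteq> ?e t"
      then obtain z where z: "x = ?e z" "z \<in> X" "v \<in> B z" "z \<noteq> t" by blast
      then have "z \<noteq> []" "v \<in> B (tl z)" using t(3) by blast+
      then show "x \<noteq> ?e [] \<and> par x \<in> ?e ` {x \<in> X. v \<in> B x}"
        using z X(3) by (auto simp: par_def)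
    qed (use t in auto)
  qed
  show ?thesis
  proof (rule that[of P.T B' "?e []"])
    show "weak_tree_decomposition G P.T B'"
      unfolding weak_tree_decomposition_def
    proof (intro conjI bags ballI, clarify)
      fix v w assume vw: "(v, w) \<in> parcs G"
      then obtain x where x: "x \<in> X" "v \<in> B x \<union> B (tl x)" "w \<in> B x \<union> B (tl x)"
        using D(4) G.in_arcsD1 G.in_arcsD2 by blast
      show "\<exists>x\<in>pverts P.T. \<exists>y\<in>pverts P.T. ((x, y) \<in> parcs P.T \<or> x = y) \<and>
          v \<in> B' x \<union> B' y \<and> w \<in> B' x \<union> B' y"
      proof (intro bexI conjI)
        \<comment> \<open>At the root \<open>tl [] = []\<close>, so an edge inside the root bag
          falls under the case \<open>x = y\<close> of the weak decomposition.\<close>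
        show "(?e x, ?e (tl x)) \<in> parcs P.T \<or> ?e x = ?e (tl x)"
          unfolding P.parcs_T using x X by (cases "x = []") (simp_all add: par_def)
      qed (use x X in \<open>auto simp: B'_def\<close>)
    qed
    show "slick s G P.T (?e []) B'"
      unfolding slick_def
    proof (intro allI impI ballI)
      fix x y v assume "is_parent P.T (?e []) x y" and v: "v \<in> B' x \<inter> B' y"
      then obtain z where "z \<in> X" "y = ?e z" "z \<noteq> []" "x = ?e (tl z)"
        using P.is_parent_T by (fastforce simp: par_def)
      then show "s \<le> card ((neighbours G v \<inter> B' y) - B' x)"
        using D(5)[of z v] v by (simp add: B'_def)
    qed
    show "card (pverts P.T) = card X" using inj by (simp add: card_image)
    show "B' ` pverts P.T = B ` X" by (auto simp: B'_def image_image)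
    show "\<forall>v. spread P.T B' v = card {x \<in> X. v \<in> B x}"
      unfolding spread_def nodes using inj by (simp add: card_image)
    show "max_degree P.T \<le> m"
    proof -
      have "degree P.T (?e x) \<le> m" if "x \<in> X" for x
      proof -
        have "{y \<in> ?e ` X. y \<noteq> ?e [] \<and> par y = ?e x} = ?e ` children X x"
          by (auto simp: children_def par_def)
        then have "card {y \<in> ?e ` X. y \<noteq> ?e [] \<and> par y = ?e x} = card (children X x)"
          using inj by (simp add: card_image)
        then show ?thesis using P.degree_T_le[of "?e x"] deg[OF that] by (simp split: if_splits)
      qed
      then show ?thesis
        unfolding max_degree_def using X(1,2) by (subst Max_le_iff) auto
    qed
  qed (use X in auto)
qed

section \<open>One-node decompositions and new roots\<close>

lemma slick_decomposition_singleton: "slick_decomposition s G U {[]} (\<lambda>_. U)"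
  by (auto simp: slick_decomposition_def list_tree_def)

text \<open>Lists are read from a node up to the root, so a new root is put on top by appending a
  letter at the end: the old root becomes \<open>[0]\<close>, and \<open>butlast\<close> recovers
  the old name. The three assumptions on \<open>R\<close> give connectedness, edge coverage and
  slickness across the new tree edge.\<close>

lemma slick_decomposition_add_root:
  assumes dec: "slick_decomposition s G U X B" and G: "pair_graph G"
    and R: "R \<inter> U \<subseteq> B []"
    and edges: "\<And>v w. v \<in> R - U \<Longrightarrow> w \<in> U - R \<Longrightarrow> (v, w) \<in> parcs G \<Longrightarrow> w \<in> B []"
    and sl: "\<And>v. v \<in> R \<inter> U \<Longrightarrow> s \<le> card ((neighbours G v \<inter> B []) - R)"
  shows "slick_decomposition s G (R \<union> U) (insert [] ((\<lambda>x. x @ [0]) ` X))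
    (\<lambda>x. if x = [] then R else B (butlast x))"
    (is "slick_decomposition s G _ ?X ?B")
proof -
  interpret pair_graph G by fact
  note D = slick_decompositionD[OF dec]
  note X = list_treeD[OF D(1)]
  have tl_snoc: "tl (x @ [0]) = (if x = [] then [] else tl x @ [0])" for x :: "nat list"
    by (cases x) auto
  have Btl: "?B (tl (x @ [0])) = (if x = [] then R else B (tl x))" for x
    by (simp add: tl_snoc)
  have edge: "\<exists>x\<in>?X. v \<in> ?B x \<union> ?B (tl x) \<and> w \<in> ?B x \<union> ?B (tl x)"
    if "v \<in> R \<union> U" "w \<in> R - U" "(v, w) \<in> parcs G" for v w
  proof -
    \<comment> \<open>The bags \<open>R\<close> and \<open>B []\<close> of the new and the old root
      together cover every edge with an end in \<open>R - U\<close>.\<close>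
    have "v \<in> R \<union> B []"
      using that edges[of w v] arcs_symmetric[of v w] by blast
    then show ?thesis using that X(2) by (intro bexI[of _ "[0]"]) auto
  qed
  show ?thesis
    unfolding slick_decomposition_def
  proof (intro conjI ballI impI)
    show "list_tree ?X"
      using X by (auto simp: list_tree_def tl_snoc)
    show "?B x \<subseteq> R \<union> U" if "x \<in> ?X" for x
      using that D(2) by fastforce
    show "\<exists>t\<in>?X. v \<in> ?B t \<and> (\<forall>x\<in>?X. v \<in> ?B x \<longrightarrow> x = t \<or> x \<noteq> [] \<and> v \<in> ?B (tl x))"
      if v: "v \<in> R \<union> U" for v
    proof (cases "v \<in> R")
      case True
      have "v \<in> ?B (tl (x @ [0]))" if "x \<in> X" "v \<in> B x" for x
      proof -
        have "v \<in> U" using D(2) that by blast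
        then have "v \<in> B []" using R True by blast
        then have "x = [] \<or> v \<in> B (tl x)" using D(3)[OF \<open>v \<in> U\<close>] X(2) that by blast
        then show ?thesis unfolding Btl using True by auto
      qed
      then show ?thesis using True by (intro bexI[of _ "[]"]) auto
    next
      case False
      then have "v \<in> U" using v by blast
      then obtain t where t: "t \<in> X" "v \<in> B t"
        "\<And>x. x \<in> X \<Longrightarrow> v \<in> B x \<Longrightarrow> x = t \<or> x \<noteq> [] \<and> v \<in> B (tl x)"
        using D(3) by blast
      have "x = t \<or> v \<in> ?B (tl (x @ [0]))" if "x \<in> X" "v \<in> B x" for x
        unfolding Btl using t(3)[OF that] by auto
      then show ?thesis using t False by (intro bexI[of _ "t @ [0]"]) auto
    qed
    show "\<exists>x\<in>?X. v \<in> ?B x \<union> ?B (tl x) \<and> w \<in> ?B x \<union> ?B (tl x)"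
      if vw: "v \<in> R \<union> U" "w \<in> R \<union> U" "(v, w) \<in> parcs G" for v w
    proof (cases "v \<in> U \<and> w \<in> U")
      case False
      then show ?thesis using edge[of v w] edge[of w v] vw arcs_symmetric[of v w] by blast
    next
      case True
      then obtain x where x: "x \<in> X" "v \<in> B x \<union> B (tl x)" "w \<in> B x \<union> B (tl x)"
        using D(4) vw by blast
      have "B x \<union> B (tl x) \<subseteq> ?B (x @ [0]) \<union> ?B (tl (x @ [0]))"
        unfolding Btl by auto
      then show ?thesis using x by blast
    qed
    show "s \<le> card ((neighbours G v \<inter> ?B y) - ?B (tl y))"
      if y: "y \<in> ?X" "y \<noteq> []" and v: "v \<in> ?B y \<inter> ?B (tl y)" for y v
    proof -
      obtain x where x: "x \<in> X" "y = x @ [0]" using y by blast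
      have 1: "?B y = B x" "?B (tl y) = (if x = [] then R else B (tl x))"
        unfolding x(2) Btl by simp_all
      show ?thesis
      proof (cases "x = []")
        case True
        have "v \<in> R \<inter> U" using v D(2)[OF x(1)] True unfolding 1 by auto
        then show ?thesis unfolding 1 using sl True by simp
      next
        case False
        then show ?thesis unfolding 1 using D(5)[OF x(1) False] v 1 by simp
      qed
    qed
  qed
qed

lemma children_add_root:
  "children (insert [] ((\<lambda>x. x @ [0]) ` X)) (x @ [0]) = (\<lambda>x. x @ [0]) ` children X x"
  "[] \<in> X \<Longrightarrow> children (insert [] ((\<lambda>x. x @ [0]) ` X)) [] = {[0]}"
  by (auto simp: children_def tl_append split: list.splits)

section \<open>Gluing two decompositions at their roots\<close>

text \<open>Even and odd letters keep the two trees apart, except for the common root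
  \<open>[]\<close>. Recoding every letter commutes with \<open>tl\<close> and so preserves
  parents.\<close>

definition merged_nodes :: "nat list set \<Rightarrow> nat list set \<Rightarrow> nat list set" where
  "merged_nodes X Y = map (\<lambda>n. 2 * n) ` X \<union> map (\<lambda>n. Suc (2 * n)) ` Y"

definition merged_bags :: "(nat list \<Rightarrow> 'a set) \<Rightarrow> (nat list \<Rightarrow> 'a set) \<Rightarrow> nat list \<Rightarrow> 'a set" where
  "merged_bags B C x =
    (if x = [] then B [] \<union> C []
     else if even (hd x) then B (map (\<lambda>n. n div 2) x) else C (map (\<lambda>n. n div 2) x))"

lemma map_div2: "map (\<lambda>n. n div 2) (map (\<lambda>n. 2 * n) x) = x"
  "map (\<lambda>n. n div 2) (map (\<lambda>n. Suc (2 * n)) x) = (x :: nat list)"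
  by (induct x) auto

lemma merged_bags_simps:
  "merged_bags B C [] = B [] \<union> C []"
  "x \<noteq> [] \<Longrightarrow> merged_bags B C (map (\<lambda>n. 2 * n) x) = B x"
  "x \<noteq> [] \<Longrightarrow> merged_bags B C (map (\<lambda>n. Suc (2 * n)) x) = C x"
  by (simp_all add: merged_bags_def map_div2 hd_map del: map_map)

lemma inj_double: "inj_on (map (\<lambda>n. 2 * n)) X" "inj_on (map (\<lambda>n. Suc (2 * n))) (X :: nat list set)"
  by (metis (mono_tags, lifting) inj_on_inverseI map_div2)+

lemma double_eq_double_Suc:
  "map (\<lambda>n. 2 * n) x = map (\<lambda>n. Suc (2 * n)) y \<longleftrightarrow> x = [] \<and> (y :: nat list) = []"
proof (cases x; cases y)
  fix a b :: nat and xs ys assume xy: "x = a # xs" "y = b # ys"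
  have "2 * a \<noteq> Suc (2 * b)" by presburger
  then show ?thesis using xy by simp
qed auto

lemma card_merged_nodes:
  assumes "list_tree X" "list_tree Y"
  shows "card (merged_nodes X Y) + 1 = card X + card Y"
proof -
  note X = list_treeD[OF assms(1)] and Y = list_treeD[OF assms(2)]
  have "map (\<lambda>n. 2 * n) ` X \<inter> map (\<lambda>n. Suc (2 * n)) ` Y = {[]}"
    using X Y double_eq_double_Suc by (auto simp: image_iff)
  then show ?thesis
    unfolding merged_nodes_def
    using card_Un_Int[of "map (\<lambda>n. 2 * n) ` X" "map (\<lambda>n. Suc (2 * n)) ` Y"] X Y
    by (simp add: card_image inj_double)
qed

lemma children_merged_nodes:
  "x \<noteq> [] \<Longrightarrow> children (merged_nodes X Y) (map (\<lambda>n. 2 * n) x) = map (\<lambda>n. 2 * n) ` children X x"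
  "y \<noteq> [] \<Longrightarrow> children (merged_nodes X Y) (map (\<lambda>n. Suc (2 * n)) y) = map (\<lambda>n. Suc (2 * n)) ` children Y y"
  "children (merged_nodes X Y) [] =
    map (\<lambda>n. 2 * n) ` children X [] \<union> map (\<lambda>n. Suc (2 * n)) ` children Y []"
proof -
  note inj = inj_double(1)[of UNIV, THEN inj_eq] inj_double(2)[of UNIV, THEN inj_eq]
  note eq = double_eq_double_Suc double_eq_double_Suc[THEN eq_iff_swap]
  show "children (merged_nodes X Y) (map (\<lambda>n. 2 * n) x) = map (\<lambda>n. 2 * n) ` children X x" if "x \<noteq> []"
    using that by (auto simp: children_def merged_nodes_def inj eq simp flip: map_tl)
  show "children (merged_nodes X Y) (map (\<lambda>n. Suc (2 * n)) y) = map (\<lambda>n. Suc (2 * n)) ` children Y y"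
    if "y \<noteq> []"
    using that by (auto simp: children_def merged_nodes_def inj eq simp flip: map_tl)
  show "children (merged_nodes X Y) [] =
    map (\<lambda>n. 2 * n) ` children X [] \<union> map (\<lambda>n. Suc (2 * n)) ` children Y []"
    by (auto simp: children_def merged_nodes_def simp flip: map_tl)
qed

text \<open>Since the overlap lies in both root bags, a merged bag restricted to \<open>U1\<close>
  or \<open>U2\<close> is the original bag. The topmost nodes, the covered edges and the slickness
  therefore carry over from the two parts.\<close>

lemma slick_decomposition_merge:
  assumes dec1: "slick_decomposition s G U1 X1 B1" and dec2: "slick_decomposition s G U2 X2 B2"
    and G: "pair_graph G" and sub: "U1 \<inter> U2 \<subseteq> B1 []" "U1 \<inter> U2 \<subseteq> B2 []"
    and sep: "\<And>v w. v \<in> U1 - U2 \<Longrightarrow> w \<in> U2 - U1 \<Longrightarrow> (v, w) \<notin> parcs G"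
  shows "slick_decomposition s G (U1 \<union> U2) (merged_nodes X1 X2) (merged_bags B1 B2)"
    (is "slick_decomposition s G _ ?X ?B")
proof -
  interpret pair_graph G by fact
  note D1 = slick_decompositionD[OF dec1] and D2 = slick_decompositionD[OF dec2]
  note X1 = list_treeD[OF D1(1)] and X2 = list_treeD[OF D2(1)]
  let ?e1 = "map (\<lambda>n. 2 * n) :: nat list \<Rightarrow> nat list"
  let ?e2 = "map (\<lambda>n. Suc (2 * n)) :: nat list \<Rightarrow> nat list"
  have tl1: "tl (?e1 x) = ?e1 (tl x)" and tl2: "tl (?e2 x) = ?e2 (tl x)" for x
    by (simp_all flip: map_tl)
  \<comment> \<open>At the root, \<open>B2 []\<close> meets \<open>U1\<close> only in the overlap,
    which \<open>B1 []\<close> already contains.\<close>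
  have r1: "?B (?e1 x) \<inter> U1 = B1 x" if "x \<in> X1" for x
  proof (cases "x = []")
    case True
    then show ?thesis
      using sub D1(2)[OF X1(2)] D2(2)[OF X2(2)] by (auto simp: merged_bags_simps)
  next
    case False
    then show ?thesis using D1(2)[OF that] by (auto simp: merged_bags_simps)
  qed
  have r2: "?B (?e2 x) \<inter> U2 = B2 x" if "x \<in> X2" for x
  proof (cases "x = []")
    case True
    then show ?thesis
      using sub D1(2)[OF X1(2)] D2(2)[OF X2(2)] by (auto simp: merged_bags_simps)
  next
    case False
    then show ?thesis using D2(2)[OF that] by (auto simp: merged_bags_simps)
  qed
  have in1: "?e1 x \<in> ?X" if "x \<in> X1" for x using that by (simp add: merged_nodes_def)
  have in2: "?e2 x \<in> ?X" if "x \<in> X2" for x using that by (simp add: merged_nodes_def)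
  have cases: "(\<exists>x\<in>X1. x \<noteq> [] \<and> y = ?e1 x) \<or> (\<exists>x\<in>X2. x \<noteq> [] \<and> y = ?e2 x)"
    if "y \<in> ?X" "y \<noteq> []" for y
    using that by (auto simp: merged_nodes_def)
  \<comment> \<open>A vertex of the overlap has the common root as its topmost node.\<close>
  have root: "x = [] \<or> x \<noteq> [] \<and> v \<in> ?B (tl x)" if "v \<in> U1 \<inter> U2" "x \<in> ?X" "v \<in> ?B x" for x v
  proof (cases "x = []")
    case False
    from cases[OF that(2) False] show ?thesis
    proof (elim disjE bexE conjE)
      fix z assume z: "z \<in> X1" "z \<noteq> []" "x = ?e1 z"
      have "v \<in> B1 z" using r1[OF z(1)] z(3) that by blast
      then have "v \<in> B1 (tl z)" using D1(3)[of v] z that X1(2) sub by blast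
      then show ?thesis using r1[OF X1(3)[OF z(1)]] z False by (auto simp: tl1)
    next
      fix z assume z: "z \<in> X2" "z \<noteq> []" "x = ?e2 z"
      have "v \<in> B2 z" using r2[OF z(1)] z(3) that by blast
      then have "v \<in> B2 (tl z)" using D2(3)[of v] z that X2(2) sub by blast
      then show ?thesis using r2[OF X2(3)[OF z(1)]] z False by (auto simp: tl2)
    qed
  qed simp
  show ?thesis
    unfolding slick_decomposition_def
  proof (intro conjI ballI impI)
    show "list_tree ?X"
      using X1 X2 by (auto simp: list_tree_def merged_nodes_def simp flip: map_tl)
    show "?B x \<subseteq> U1 \<union> U2" if "x \<in> ?X" for x
    proof (cases "x = []")
      case True
      then show ?thesis using D1(2)[OF X1(2)] D2(2)[OF X2(2)] by (auto simp: merged_bags_simps)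
    next
      case False
      then show ?thesis using cases[OF that False] D1(2) D2(2) by (fastforce simp: merged_bags_simps)
    qed
    show "\<exists>t\<in>?X. v \<in> ?B t \<and> (\<forall>x\<in>?X. v \<in> ?B x \<longrightarrow> x = t \<or> x \<noteq> [] \<and> v \<in> ?B (tl x))"
      if v: "v \<in> U1 \<union> U2" for v
    proof -
      consider "v \<in> U1 \<inter> U2" | "v \<in> U1" "v \<notin> U2" | "v \<in> U2" "v \<notin> U1" using v by blast
      then show ?thesis
      proof cases
        case 1
        then have "v \<in> ?B []" using sub by (auto simp: merged_bags_simps)
        then show ?thesis
          using root[OF 1] in1[OF X1(2)] by (intro bexI[of _ "[]"]) auto
      next
        case 2
        then obtain t where t: "t \<in> X1" "v \<in> B1 t"
          "\<And>x. x \<in> X1 \<Longrightarrow> v \<in> B1 x \<Longrightarrow> x = t \<or> x \<noteq> [] \<and> v \<in> B1 (tl x)"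
          using D1(3) by blast
        have "x = ?e1 t \<or> x \<noteq> [] \<and> v \<in> ?B (tl x)" if x: "x \<in> ?X" "v \<in> ?B x" for x
        proof -
          have "\<exists>z\<in>X1. x = ?e1 z"
          proof (cases "x = []")
            case True
            then show ?thesis using X1(2) by force
          next
            case False
            then show ?thesis
              using cases[OF x(1) False] x(2) 2 D2(2) by (fastforce simp: merged_bags_simps)
          qed
          then obtain z where z: "z \<in> X1" "x = ?e1 z" by blast
          then have "v \<in> B1 z" using r1 x 2 by blast
          then have "z = t \<or> z \<noteq> [] \<and> v \<in> B1 (tl z)" using t(3) z by blast
          then show ?thesis using r1[OF X1(3)[OF z(1)]] z by (auto simp: tl1)
        qed
        then show ?thesis using t r1[OF t(1)] in1[OF t(1)] by (intro bexI[of _ "?e1 t"]) auto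
      next
        case 3
        then obtain t where t: "t \<in> X2" "v \<in> B2 t"
          "\<And>x. x \<in> X2 \<Longrightarrow> v \<in> B2 x \<Longrightarrow> x = t \<or> x \<noteq> [] \<and> v \<in> B2 (tl x)"
          using D2(3) by blast
        have "x = ?e2 t \<or> x \<noteq> [] \<and> v \<in> ?B (tl x)" if x: "x \<in> ?X" "v \<in> ?B x" for x
        proof -
          have "\<exists>z\<in>X2. x = ?e2 z"
          proof (cases "x = []")
            case True
            then show ?thesis using X2(2) by force
          next
            case False
            then show ?thesis
              using cases[OF x(1) False] x(2) 3 D1(2) by (fastforce simp: merged_bags_simps)
          qed
          then obtain z where z: "z \<in> X2" "x = ?e2 z" by blast
          then have "v \<in> B2 z" using r2 x 3 by blast
          then have "z = t \<or> z \<noteq> [] \<and> v \<in> B2 (tl z)" using t(3) z by blast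
          then show ?thesis using r2[OF X2(3)[OF z(1)]] z by (auto simp: tl2)
        qed
        then show ?thesis using t r2[OF t(1)] in2[OF t(1)] by (intro bexI[of _ "?e2 t"]) auto
      qed
    qed
    show "\<exists>x\<in>?X. v \<in> ?B x \<union> ?B (tl x) \<and> w \<in> ?B x \<union> ?B (tl x)"
      if vw: "v \<in> U1 \<union> U2" "w \<in> U1 \<union> U2" "(v, w) \<in> parcs G" for v w
    proof -
      have "v \<in> U1 \<and> w \<in> U1 \<or> v \<in> U2 \<and> w \<in> U2"
        using sep[of v w] sep[of w v] vw arcs_symmetric[of v w] by blast
      then show ?thesis
      proof (elim disjE conjE)
        assume "v \<in> U1" "w \<in> U1"
        then obtain x where x: "x \<in> X1" "v \<in> B1 x \<union> B1 (tl x)" "w \<in> B1 x \<union> B1 (tl x)"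
          using D1(4) vw by blast
        have "B1 x \<union> B1 (tl x) \<subseteq> ?B (?e1 x) \<union> ?B (tl (?e1 x))"
          unfolding tl1 using r1[OF x(1)] r1[OF X1(3)[OF x(1)]] by blast
        then show ?thesis using in1[OF x(1)] x by blast
      next
        assume "v \<in> U2" "w \<in> U2"
        then obtain x where x: "x \<in> X2" "v \<in> B2 x \<union> B2 (tl x)" "w \<in> B2 x \<union> B2 (tl x)"
          using D2(4) vw by blast
        have "B2 x \<union> B2 (tl x) \<subseteq> ?B (?e2 x) \<union> ?B (tl (?e2 x))"
          unfolding tl2 using r2[OF x(1)] r2[OF X2(3)[OF x(1)]] by blast
        then show ?thesis using in2[OF x(1)] x by blast
      qed
    qed
    show "s \<le> card ((neighbours G v \<inter> ?B y) - ?B (tl y))"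
      if y: "y \<in> ?X" "y \<noteq> []" and v: "v \<in> ?B y \<inter> ?B (tl y)" for y v
      using cases[OF y]
    proof (elim disjE bexE conjE)
      fix x assume x: "x \<in> X1" "x \<noteq> []" "y = ?e1 x"
      \<comment> \<open>The bag of the non-root node \<open>y\<close> lies inside \<open>U1\<close>,
        so enlarging the root bag by vertices outside \<open>U1\<close> removes no neighbour from
        the count.\<close>
      have "?B y = B1 x" using x by (simp add: merged_bags_simps)
      moreover have "?B (tl y) \<inter> U1 = B1 (tl x)" using r1[OF X1(3)[OF x(1)]] x by (simp add: tl1)
      ultimately have "v \<in> B1 x" "v \<in> B1 (tl x)"
        "(neighbours G v \<inter> ?B y) - ?B (tl y) = (neighbours G v \<inter> B1 x) - B1 (tl x)"
        using v D1(2)[OF x(1)] by blast+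
      then show ?thesis using D1(5)[OF x(1,2)] by simp
    next
      fix x assume x: "x \<in> X2" "x \<noteq> []" "y = ?e2 x"
      have "?B y = B2 x" using x by (simp add: merged_bags_simps)
      moreover have "?B (tl y) \<inter> U2 = B2 (tl x)" using r2[OF X2(3)[OF x(1)]] x by (simp add: tl2)
      ultimately have "v \<in> B2 x" "v \<in> B2 (tl x)"
        "(neighbours G v \<inter> ?B y) - ?B (tl y) = (neighbours G v \<inter> B2 x) - B2 (tl x)"
        using v D2(2)[OF x(1)] by blast+
      then show ?thesis using D2(5)[OF x(1,2)] by simp
    qed
  qed
qed

section \<open>The recursive construction\<close>

lemma card_bags_le_width:
  assumes "pair_graph T" "x \<in> pverts T"
  shows "int (card (B x)) \<le> width T B + 1"
proof -
  interpret pair_graph T by fact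
  show ?thesis using pair_finite_verts assms(2) by (simp add: width_def)
qed

text \<open>This makes the set of widths in the definition of \<open>treewidth\<close>
  nonempty.\<close>

lemma exists_trivial_tree_decomposition:
  assumes G: "pair_graph G"
  shows "tree_decomposition G (parent_graph {0 :: nat} 0 id) (\<lambda>_. pverts G)"
proof -
  interpret G: pair_graph G by fact
  interpret P: parent_tree "{0 :: nat}" 0 id id by unfold_locales auto
  have "Digraph_Component.connected (with_proj P.T \<restriction> {0})"
    by (rule P.connected_closed_set[of _ 0]) auto
  moreover have "bag_nodes P.T (\<lambda>_. pverts G) v = {0}" if "v \<in> pverts G" for v
    using that by (auto simp: bag_nodes_def)
  ultimately show ?thesis
    using P.undirected_tree_T G.in_arcsD1 G.in_arcsD2
    by (auto simp: tree_decomposition_def tree_bags_def)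
qed

text \<open>If all widths were at least \<open>k\<close>, so would be their infimum.\<close>

lemma treewidth_witness:
  assumes G: "pair_graph G" and tw: "treewidth G < k"
  shows "\<exists>(T :: nat pair_pre_digraph) B. tree_decomposition G T B \<and> width T B < k"
proof (rule ccontr)
  assume no: "\<not> ?thesis"
  let ?W = "{width T B | (T :: nat pair_pre_digraph) B. tree_decomposition G T B}"
  have "k \<le> Inf ?W"
  proof (rule cInf_greatest)
    show "?W \<noteq> {}" using exists_trivial_tree_decomposition[OF G] by blast
    show "k \<le> w" if w: "w \<in> ?W" for w
    proof -
      obtain T :: "nat pair_pre_digraph" and B where "tree_decomposition G T B" "w = width T B"
        using w by blast
      then show ?thesis using no not_less by blast
    qed
  qed
  then show False using tw by (simp add: treewidth_def)
qed

text \<open>Each \<open>v\<close> in \<open>R\<close> contributes at most \<open>d\<close> vertices: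
  all its neighbours in \<open>U - R\<close> if there are at most \<open>d - 1\<close>, and
  otherwise \<open>v\<close> itself with \<open>d - 1\<close> of them. \<open>P\<close> is the union
  of these contributions.\<close>

lemma exists_next_bag:
  assumes G: "pair_graph G" and U: "U \<subseteq> pverts G" and R: "R \<subseteq> U"
    and d: "1 \<le> d"
  obtains P where "P \<subseteq> U" "card P \<le> d * card R"
    "\<And>v. v \<in> R \<inter> P \<Longrightarrow> d - 1 \<le> card ((neighbours G v \<inter> P) - R)"
    "\<And>v. v \<in> R - P \<Longrightarrow> (neighbours G v \<inter> U) - R \<subseteq> P"
proof -
  interpret pair_graph G by fact
  have fU: "finite U" using U pair_finite_verts by (rule finite_subset)
  let ?N = "\<lambda>v. (neighbours G v \<inter> U) - R"
  have "\<exists>Q. Q \<subseteq> insert v (?N v) \<and> card Q \<le> d \<and> (v \<in> Q \<longrightarrow> d - 1 \<le> card (Q - R)) \<and> (v \<notin> Q \<longrightarrow> ?N v \<subseteq> Q)"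
    if v: "v \<in> R" for v
  proof (cases "card (?N v) \<le> d - 1")
    case True
    then show ?thesis using v by (intro exI[of _ "?N v"]) auto
  next
    case False
    then obtain M where M: "M \<subseteq> ?N v" "card M = d - 1" "finite M"
      using obtain_subset_with_card_n[of "d - 1" "?N v"] by (metis nat_le_linear)
    then have "card (insert v M) \<le> d" using d card_insert_le_m1[of d M v] by simp
    moreover have "insert v M - R = M" using M v by blast
    ultimately show ?thesis using M by (intro exI[of _ "insert v M"]) auto
  qed
  then obtain Q where Q: "\<And>v. v \<in> R \<Longrightarrow> Q v \<subseteq> insert v (?N v)" "\<And>v. v \<in> R \<Longrightarrow> card (Q v) \<le> d"
    "\<And>v. v \<in> R \<Longrightarrow> v \<in> Q v \<Longrightarrow> d - 1 \<le> card (Q v - R)" "\<And>v. v \<in> R \<Longrightarrow> v \<notin> Q v \<Longrightarrow> ?N v \<subseteq> Q v"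
    by metis
  let ?P = "\<Union>v\<in>R. Q v"
  show ?thesis
  proof (rule that[of ?P])
    show PU: "?P \<subseteq> U" using Q(1) R by blast
    have fR: "finite R" using R fU by (rule finite_subset)
    then have "card ?P \<le> (\<Sum>v\<in>R. card (Q v))" by (rule card_UN_le)
    also have "\<dots> \<le> card R * d" using sum_bounded_above[of R "\<lambda>v. card (Q v)" d] Q(2) by simp
    finally show "card ?P \<le> d * card R" by (simp add: mult.commute)
    show "d - 1 \<le> card ((neighbours G v \<inter> ?P) - R)" if v: "v \<in> R \<inter> ?P" for v
    proof -
      \<comment> \<open>The contributions of other vertices of \<open>R\<close> meet
        \<open>R\<close> at most in those vertices, so \<open>v\<close> can only come from
        \<open>Q v\<close>.\<close>
      have "v \<in> Q v" using v Q(1) by blast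
      then have "d - 1 \<le> card (Q v - R)" using Q(3) v by blast
      also have "\<dots> \<le> card ((neighbours G v \<inter> ?P) - R)"
        using v Q(1)[of v] PU fU by (intro card_mono) (auto intro: finite_subset)
      finally show ?thesis .
    qed
    show "?N v \<subseteq> ?P" if "v \<in> R - ?P" for v using that Q(4)[of v] by blast
  qed
qed

text \<open>The bounds on the root bag and on the root's children are relative to
  \<open>card S\<close>, so that they survive repeated gluing at the root; with
  \<open>card S \<le> 12 * k * d\<close> they give bags of size at most \<open>18 * k * d\<close>
  and degree at most \<open>6 * d\<close>. The degree bound reserves one for a later parent.\<close>

lemma exists_rooted_slick_decomposition:
  assumes G: "pair_graph G" and dec: "tree_decomposition G T0 B0"
    and bags: "\<And>x. x \<in> pverts T0 \<Longrightarrow> card (B0 x) \<le> k" and k: "1 \<le> k" and d: "2 \<le> d"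
  shows "S \<subseteq> U \<Longrightarrow> U \<subseteq> pverts G \<Longrightarrow> 4 * k \<le> card S \<Longrightarrow> card S \<le> 12 * k * d \<Longrightarrow>
    \<exists>X B. slick_decomposition (d - 1) G U X B \<and> S \<subseteq> B [] \<and>
      2 * card (B []) + 4 * k \<le> 3 * card S \<and>
      2 * k * (card (children X []) + 1) \<le> card S \<and>
      6 * k * card X + card S \<le> 3 * card U + 4 * k \<and>
      (\<forall>x\<in>X. card (B x) \<le> 18 * k * d) \<and>
      (\<forall>x\<in>X. x \<noteq> [] \<longrightarrow> card (children X x) + 1 \<le> 6 * d)"
proof (induct "2 * card U - card S" arbitrary: S U rule: less_induct)
  case less
  interpret G: pair_graph G by fact
  have fU: "finite U" using less.prems(2) G.pair_finite_verts by (rule finite_subset)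
  then have fS: "finite S" using less.prems(1) finite_subset by blast
  have SU: "card S \<le> card U" using less.prems(1) fU by (rule card_mono[rotated])
  have US: "card (U - S) = card U - card S" using fS less.prems(1) by (rule card_Diff_subset)
  have "k * 2 \<le> k * d" using d by simp
  then have kd: "2 * k \<le> k * d" by linarith
  show ?case
  proof (cases "card S \<le> 12 * k")
    case small: True
    show ?thesis
    proof (cases "card (U - S) < 6 * k")
      case True
      \<comment> \<open>Few vertices remain, so the bags \<open>S\<close> and \<open>U - S\<close>
        on a single tree edge suffice; they are disjoint, which makes slickness vacuous.\<close>
      let ?X = "insert [] ((\<lambda>x. x @ [0]) ` {[]}) :: nat list set"
      let ?B = "\<lambda>x. if x = [] then S else U - S"
      have "slick_decomposition (d - 1) G (S \<union> (U - S)) ?X ?B"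
        by (rule slick_decomposition_add_root[OF slick_decomposition_singleton G]) auto
      then have "slick_decomposition (d - 1) G U ?X ?B"
        using less.prems(1) by (simp add: Un_absorb1)
      moreover have "children ?X [] = {[0]}" "children ?X [0] = {}"
        by (auto simp: children_def)
      ultimately show ?thesis
        using less.prems True SU kd d by (intro exI[of _ ?X] exI[of _ ?B]) auto
    next
      case False
      obtain P where P: "P \<subseteq> U" "card P \<le> d * card S"
        "\<And>v. v \<in> S \<inter> P \<Longrightarrow> d - 1 \<le> card ((neighbours G v \<inter> P) - S)"
        "\<And>v. v \<in> S - P \<Longrightarrow> (neighbours G v \<inter> U) - S \<subseteq> P"
        using exists_next_bag[OF G less.prems(2,1), of d] d by auto
      have fP: "finite P" using P(1) fU by (rule finite_subset)
      have dS: "d * card S \<le> 12 * k * d" using mult_le_mono1[OF small, of d] by (simp add: mult.commute)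
      \<comment> \<open>\<open>M\<close> is \<open>P - S\<close>, padded to \<open>6 * k\<close>
        vertices if it is smaller. In the padded case the sum is at most
        \<open>12 * k + 6 * k\<close>, which is below \<open>12 * k * d\<close> because
        \<open>d \<ge> 2\<close>.\<close>
      obtain M where M: "P - S \<subseteq> M" "M \<subseteq> U - S" "6 * k \<le> card M"
        "card (P \<inter> S) + card M \<le> 12 * k * d"
      proof (cases "6 * k \<le> card (P - S)")
        case True
        have "card (P \<inter> S) + card (P - S) = card P"
          using fP by (metis card_Diff_subset_Int card_mono finite_Int inf_le1 le_add_diff_inverse)
        then show ?thesis using that[of "P - S"] P True dS by auto
      next
        case no: False
        then obtain M where M: "P - S \<subseteq> M" "M \<subseteq> U - S" "card M = 6 * k"
          using exists_subset_between[of "P - S" "6 * k" "U - S"] False fU P(1) by auto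
        have "card (P \<inter> S) \<le> card S" using fS by (intro card_mono) auto
        then show ?thesis using that[of M] M small kd by simp
      qed
      \<comment> \<open>Only the vertices of \<open>S\<close> that are repeated in \<open>P\<close>
        stay in the remaining graph; \<open>S'\<close> is prescribed for the root bag below
        \<open>S\<close>.\<close>
      define S' where "S' = (P \<inter> S) \<union> M"
      define U' where "U' = (P \<inter> S) \<union> (U - S)"
      have fM: "finite M" using M(2) fU finite_subset by blast
      have cS': "card S' = card (P \<inter> S) + card M"
        unfolding S'_def using M(2) fM fP by (intro card_Un_disjoint) auto
      have cU': "card U' = card (P \<inter> S) + (card U - card S)"
        unfolding U'_def US[symmetric] using fU fP by (intro card_Un_disjoint) auto
      have cPS: "card (P \<inter> S) \<le> card S" using fS by (intro card_mono) auto
      have cMU: "card M \<le> card U - card S"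
        unfolding US[symmetric] using M(2) fU by (intro card_mono) auto
      have sub': "S' \<subseteq> U'" "U' \<subseteq> pverts G"
        using M(2) P(1) less.prems(2) by (auto simp: S'_def U'_def)
      have sz': "4 * k \<le> card S'" "card S' \<le> 12 * k * d" using M(3,4) cS' by linarith+
      \<comment> \<open>The measure drops by at least \<open>card M\<close>, which is
        positive.\<close>
      have "2 * card U' - card S' < 2 * card U - card S"
        using cS' cU' cPS cMU SU M(3) k by linarith
      from less.hyps[OF this sub' sz'] obtain X B where
        X: "slick_decomposition (d - 1) G U' X B" "S' \<subseteq> B []"
        and rootdeg: "2 * k * (card (children X []) + 1) \<le> card S'"
        and order: "6 * k * card X + card S' \<le> 3 * card U' + 4 * k"
        and bag: "\<And>x. x \<in> X \<Longrightarrow> card (B x) \<le> 18 * k * d"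
        and deg: "\<And>x. x \<in> X \<Longrightarrow> x \<noteq> [] \<Longrightarrow> card (children X x) + 1 \<le> 6 * d"
        by blast
      note lt = list_treeD[OF slick_decompositionD(1)[OF X(1)]]
      let ?X = "insert [] ((\<lambda>x. x @ [0]) ` X)" and ?B = "\<lambda>x. if x = [] then S else B (butlast x)"
      have "slick_decomposition (d - 1) G (S \<union> U') ?X ?B"
      proof (rule slick_decomposition_add_root[OF X(1) G])
        show "S \<inter> U' \<subseteq> B []" using X(2) by (auto simp: S'_def U'_def)
        show "w \<in> B []" if "v \<in> S - U'" "w \<in> U' - S" "(v, w) \<in> parcs G" for v w
          using that P(4)[of v] M(1) X(2) by (auto simp: S'_def U'_def)
        show "d - 1 \<le> card ((neighbours G v \<inter> B []) - S)" if "v \<in> S \<inter> U'" for v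
        proof -
          have "finite (B [])" using slick_decompositionD(2)[OF X(1) lt(2)] sub'(2) G.pair_finite_verts
            by (meson finite_subset)
          then have "card ((neighbours G v \<inter> P) - S) \<le> card ((neighbours G v \<inter> B []) - S)"
            using M(1) X(2) by (intro card_mono) (auto simp: S'_def)
          moreover have "v \<in> S \<inter> P" using that by (auto simp: U'_def)
          ultimately show ?thesis using P(3) by fastforce
        qed
      qed
      moreover have "S \<union> U' = U" using less.prems(1) P(1) by (auto simp: U'_def)
      moreover have "card ?X = card X + 1"
      proof -
        have "[] \<notin> (\<lambda>x. x @ [0]) ` X" by auto
        then show ?thesis using lt(1) by (simp add: card_image inj_on_def)
      qed
      \<comment> \<open>The new node costs \<open>6 * k\<close>, which is paid by the vertices of
        \<open>M\<close> in \<open>S'\<close>.\<close>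
      moreover have "6 * k * (card X + 1) + card S \<le> 3 * card U + 4 * k"
        using order cS' cU' cPS SU M(3) by (simp add: algebra_simps)
      moreover have "children ?X [] = {[0]}" by (rule children_add_root(2)[OF lt(2)])
      moreover have "card (children ?X (x @ [0])) + 1 \<le> 6 * d" if x: "x \<in> X" for x
      proof -
        have "card (children ?X (x @ [0])) = card (children X x)"
          unfolding children_add_root by (simp add: card_image inj_on_def)
        moreover have "card (children X []) + 1 \<le> 6 * d"
        proof -
          \<comment> \<open>The old root acquires a parent, for which its invariant has left
            room.\<close>
          have "2 * k * (card (children X []) + 1) \<le> 2 * k * (6 * d)" using rootdeg sz'(2) by simp
          then show ?thesis using k by (metis mult_le_cancel1 mult_pos_pos one_le_numeral order_less_le_trans zero_less_numeral less_one not_less)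
        qed
        ultimately show ?thesis using deg[OF x] by metis
      qed
      moreover have "card S \<le> 18 * k * d" using less.prems(4) by simp
      ultimately show ?thesis
        using less.prems(3) bag by (intro exI[of _ ?X] exI[of _ ?B]) auto
    qed
  next
    case False
    then obtain A I C where U: "U = A \<union> I \<union> C"
      and disj: "A \<inter> I = {}" "A \<inter> C = {}" "I \<inter> C = {}"
      and I: "card I \<le> k" and A: "4 * k \<le> card (S \<inter> A) + card I" and C: "4 * k \<le> card (S \<inter> C)"
      and sep: "\<And>v w. v \<in> A \<Longrightarrow> w \<in> C \<Longrightarrow> (v, w) \<notin> parcs G"
      using separation_of_large_set[OF dec G bags less.prems(1,2)] by (metis not_le)
    have fin: "finite A" "finite I" "finite C" using fU U by auto
    define S1 where "S1 = (S \<inter> A) \<union> I"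
    define S2 where "S2 = (S \<inter> C) \<union> I"
    have cS1: "card S1 = card (S \<inter> A) + card I"
      unfolding S1_def using fin disj by (intro card_Un_disjoint) auto
    have cS2: "card S2 = card (S \<inter> C) + card I"
      unfolding S2_def using fin disj by (intro card_Un_disjoint) auto
    have c1: "card (A \<union> I) = card A + card I" and c2: "card (C \<union> I) = card C + card I"
      using fin disj by (auto intro: card_Un_disjoint)
    have cU: "card U = card A + card I + card C"
      unfolding U using fin disj by (subst card_Un_disjoint) (auto simp: c1)
    have "S = (S \<inter> A) \<union> (S \<inter> I) \<union> (S \<inter> C)" using less.prems(1) U by blast
    then have "card S = card ((S \<inter> A) \<union> (S \<inter> I) \<union> (S \<inter> C))" by simp
    also have "\<dots> = card ((S \<inter> A) \<union> (S \<inter> I)) + card (S \<inter> C)"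
      using fin disj by (intro card_Un_disjoint) auto
    also have "card ((S \<inter> A) \<union> (S \<inter> I)) = card (S \<inter> A) + card (S \<inter> I)"
      using fin disj by (intro card_Un_disjoint) auto
    finally have cS: "card S = card (S \<inter> A) + card (S \<inter> I) + card (S \<inter> C)" .
    have le: "card (S \<inter> I) \<le> card I" "card (S \<inter> A) \<le> card A" "card (S \<inter> C) \<le> card C"
      using fin by (auto intro: card_mono)
    \<comment> \<open>\<open>S1\<close> loses at least \<open>4 * k\<close> vertices of
      \<open>S\<close> in \<open>C\<close> and gains at most \<open>k\<close> from \<open>I\<close>;
      the measure drops because \<open>C\<close> is nonempty.\<close>
    have "S1 \<subseteq> A \<union> I" "A \<union> I \<subseteq> pverts G" "4 * k \<le> card S1" "card S1 \<le> 12 * k * d"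
      "2 * card (A \<union> I) - card S1 < 2 * card U - card S"
      using less.prems A C I k le cS cS1 c1 cU U by (auto simp: S1_def)
    from less.hyps[OF this(5) this(1-4)] obtain X1 B1 where
      X1: "slick_decomposition (d - 1) G (A \<union> I) X1 B1" "S1 \<subseteq> B1 []"
      and root1: "2 * card (B1 []) + 4 * k \<le> 3 * card S1"
      and rootdeg1: "2 * k * (card (children X1 []) + 1) \<le> card S1"
      and order1: "6 * k * card X1 + card S1 \<le> 3 * card (A \<union> I) + 4 * k"
      and bag1: "\<And>x. x \<in> X1 \<Longrightarrow> card (B1 x) \<le> 18 * k * d"
      and deg1: "\<And>x. x \<in> X1 \<Longrightarrow> x \<noteq> [] \<Longrightarrow> card (children X1 x) + 1 \<le> 6 * d"
      by blast
    \<comment> \<open>Here \<open>S \<inter> A\<close> has at least \<open>4 * k - card I\<close>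
      vertices, so \<open>card S2\<close> is at most
      \<open>card S - 4 * k + 2 * card I\<close>.\<close>
    have "S2 \<subseteq> C \<union> I" "C \<union> I \<subseteq> pverts G" "4 * k \<le> card S2" "card S2 \<le> 12 * k * d"
      "2 * card (C \<union> I) - card S2 < 2 * card U - card S"
      using less.prems A C I k le cS cS2 c2 cU U by (auto simp: S2_def)
    from less.hyps[OF this(5) this(1-4)] obtain X2 B2 where
      X2: "slick_decomposition (d - 1) G (C \<union> I) X2 B2" "S2 \<subseteq> B2 []"
      and root2: "2 * card (B2 []) + 4 * k \<le> 3 * card S2"
      and rootdeg2: "2 * k * (card (children X2 []) + 1) \<le> card S2"
      and order2: "6 * k * card X2 + card S2 \<le> 3 * card (C \<union> I) + 4 * k"
      and bag2: "\<And>x. x \<in> X2 \<Longrightarrow> card (B2 x) \<le> 18 * k * d"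
      and deg2: "\<And>x. x \<in> X2 \<Longrightarrow> x \<noteq> [] \<Longrightarrow> card (children X2 x) + 1 \<le> 6 * d"
      by blast
    note D1 = slick_decompositionD[OF X1(1)] and D2 = slick_decompositionD[OF X2(1)]
    note lt1 = list_treeD[OF D1(1)] and lt2 = list_treeD[OF D2(1)]
    let ?X = "merged_nodes X1 X2" and ?B = "merged_bags B1 B2"
    have Un: "(A \<union> I) \<union> (C \<union> I) = U" and Int: "(A \<union> I) \<inter> (C \<union> I) = I"
      using U disj by auto
    have "slick_decomposition (d - 1) G ((A \<union> I) \<union> (C \<union> I)) ?X ?B"
    proof (rule slick_decomposition_merge[OF X1(1) X2(1) G])
      show "(v, w) \<notin> parcs G" if "v \<in> A \<union> I - (C \<union> I)" "w \<in> C \<union> I - (A \<union> I)" for v w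
        using that sep by blast
    qed (use X1(2) X2(2) in \<open>auto simp: Int S1_def S2_def\<close>)
    then have main: "slick_decomposition (d - 1) G U ?X ?B" unfolding Un .
    have B0: "?B [] = B1 [] \<union> B2 []" by (rule merged_bags_simps)
    have sub: "S \<subseteq> ?B []"
      unfolding B0 using less.prems(1) U X1(2) X2(2) by (auto simp: S1_def S2_def)
    have BI: "B1 [] \<inter> B2 [] = I"
      using D1(2)[OF lt1(2)] D2(2)[OF lt2(2)] X1(2) X2(2) Int by (auto simp: S1_def S2_def)
    have finB: "finite (B1 [])" "finite (B2 [])"
      using D1(2)[OF lt1(2)] D2(2)[OF lt2(2)] fin by (auto intro: finite_subset)
    have cB: "card (?B []) + card I = card (B1 []) + card (B2 [])"
      unfolding B0 using card_Un_Int[OF finB] BI by simp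
    \<comment> \<open>Adding the two bounds yields \<open>8 * k\<close> on the left; half of it pays
      for \<open>I\<close>, which is counted on both sides, as
      \<open>4 * card I \<le> 4 * k\<close>.\<close>
    have root: "2 * card (?B []) + 4 * k \<le> 3 * card S"
      using cB root1 root2 cS1 cS2 cS le I by linarith
    have ch: "card (children ?X []) \<le> card (children X1 []) + card (children X2 [])"
    proof -
      have "finite (children X1 [])" "finite (children X2 [])"
        using lt1(1) lt2(1) by (auto simp: children_def)
      then show ?thesis
        unfolding children_merged_nodes by (meson add_le_mono card_Un_le card_image_le le_trans)
    qed
    \<comment> \<open>The common root needs the reserve \<open>2 * k\<close> only once, and the
      other one covers the excess \<open>2 * card I\<close> of
      \<open>card S1 + card S2\<close>.\<close>
    have rootdeg: "2 * k * (card (children ?X []) + 1) \<le> card S"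
    proof -
      have "2 * k * (card (children ?X []) + 1) + 2 * k
          \<le> 2 * k * (card (children X1 []) + 1) + 2 * k * (card (children X2 []) + 1)"
        using mult_le_mono2[OF ch, of "2 * k"] by (simp add: algebra_simps)
      then show ?thesis using rootdeg1 rootdeg2 cS1 cS2 cS I by linarith
    qed
    \<comment> \<open>Identifying the roots saves \<open>6 * k\<close>, which pays for the second
      \<open>4 * k\<close> and for an excess of at most \<open>2 * card I\<close>.\<close>
    have order: "6 * k * card ?X + card S \<le> 3 * card U + 4 * k"
    proof -
      have "6 * k * card ?X + 6 * k = 6 * k * card X1 + 6 * k * card X2"
        using arg_cong[OF card_merged_nodes[OF D1(1) D2(1)], of "\<lambda>n. 6 * k * n"]
        by (simp add: algebra_simps)
      then show ?thesis using order1 order2 cS1 cS2 cS cU c1 c2 le I by linarith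
    qed
    have node: "x = [] \<or> (\<exists>y\<in>X1. y \<noteq> [] \<and> x = map (\<lambda>n. 2 * n) y) \<or>
        (\<exists>y\<in>X2. y \<noteq> [] \<and> x = map (\<lambda>n. Suc (2 * n)) y)" if "x \<in> ?X" for x
      using that by (auto simp: merged_nodes_def)
    have bag: "card (?B x) \<le> 18 * k * d" if "x \<in> ?X" for x
      using node[OF that]
    proof (elim disjE bexE conjE)
      assume "x = []"
      then show ?thesis using root less.prems(4) by simp
    qed (use bag1 bag2 in \<open>auto simp: merged_bags_simps\<close>)
    have deg: "card (children ?X x) + 1 \<le> 6 * d" if "x \<in> ?X" "x \<noteq> []" for x
      using node[OF that(1)] that(2) deg1 deg2
      by (auto simp: children_merged_nodes card_image inj_double simp del: One_nat_def)
    show ?thesis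
      using main sub root rootdeg order bag deg by blast
  qed
qed

section \<open>Choice of the initial set and the final bounds\<close>

theorem theorem33:
  fixes G :: "'a pair_pre_digraph" and k d :: nat
  assumes "pair_graph G"
    and "int k \<ge> treewidth G + 1"
    and "d \<ge> 2"
  shows "\<exists>(T :: nat pair_pre_digraph) r B.
    weak_tree_decomposition G T B \<and>
    r \<in> pverts T \<and> slick (d - 1) G T r B \<and>
    width T B \<le> int (18 * k * d) \<and>
    max_degree T \<le> 6 * d \<and>
    real (card (pverts T)) \<le> max (real (card (pverts G)) / (2 * real k)) 1 \<and>
    (\<forall>v\<in>pverts G. real (spread T B v) \<le> 1 + real (degree G v) / (real d - 1))"
proof -
  interpret G: pair_graph G by fact
  obtain T0 :: "nat pair_pre_digraph" and B0 where
    dec: "tree_decomposition G T0 B0" and w: "width T0 B0 < int k"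
    using treewidth_witness[OF assms(1), of "int k"] assms(2) by force
  have T0: "pair_graph T0"
    using dec by (simp add: tree_decomposition_def tree_bags_def undirected_tree_def)
  have bags: "card (B0 x) \<le> k" if "x \<in> pverts T0" for x
    using card_bags_le_width[OF T0 that, of B0] w by linarith
  \<comment> \<open>The extra 1 in the bag bound is the one subtracted in
    \<open>width\<close>.\<close>
  obtain X B where X: "slick_decomposition (d - 1) G (pverts G) X B"
    and bag: "\<And>x. x \<in> X \<Longrightarrow> card (B x) \<le> 18 * k * d + 1"
    and deg: "\<And>x. x \<in> X \<Longrightarrow> card (children X x) + (if x = [] then 0 else 1) \<le> 6 * d"
    and order: "real (card X) \<le> max (real (card (pverts G)) / (2 * real k)) 1"
  proof (cases "4 * k \<le> card (pverts G) \<and> 1 \<le> k")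
    case True
    \<comment> \<open>With exactly \<open>4 * k\<close> prescribed vertices, the terms
      \<open>4 * k\<close> in the order bound cancel and the root has at most one child.\<close>
    then obtain S where S: "S \<subseteq> pverts G" "card S = 4 * k"
      using obtain_subset_with_card_n by metis
    have "4 * k \<le> 12 * k * d" using assms(3) by simp
    then obtain X B where X: "slick_decomposition (d - 1) G (pverts G) X B"
      and rootdeg: "2 * k * (card (children X []) + 1) \<le> 4 * k"
      and order: "6 * k * card X + 4 * k \<le> 3 * card (pverts G) + 4 * k"
      and bag: "\<forall>x\<in>X. card (B x) \<le> 18 * k * d"
      and deg: "\<forall>x\<in>X. x \<noteq> [] \<longrightarrow> card (children X x) + 1 \<le> 6 * d"
      using exists_rooted_slick_decomposition[OF assms(1) dec bags _ assms(3) S(1) subset_refl,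
          unfolded S(2)] True by blast
    have "2 * k * (card (children X []) + 1) \<le> 2 * k * 2" using rootdeg by simp
    then have "card (children X []) \<le> 1" using True by (simp del: mult_Suc_right)
    moreover have "2 * k * card X \<le> card (pverts G)" using order by simp
    then have "real (2 * k * card X) \<le> real (card (pverts G))" by (rule of_nat_mono)
    then have "real (card X) \<le> real (card (pverts G)) / (2 * real k)"
      using True by (simp add: field_simps)
    ultimately show ?thesis
      using that[OF X] bag deg assms(3) by (auto simp: le_SucI)
  next
    case False
    \<comment> \<open>A single bag is used here. For \<open>k = 0\<close> all bags of the given
      decomposition are empty, so the graph has no vertices.\<close>
    have "card (pverts G) \<le> 18 * k * d + 1"
    proof (cases "k = 0")
      case True
      have "v \<notin> pverts G" for v
      proof
        assume v: "v \<in> pverts G"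
        have tb: "tree_bags G T0 B0" using dec by (simp add: tree_decomposition_def)
        have "Digraph_Component.connected (with_proj T0 \<restriction> bag_nodes T0 B0 v)"
          using tb v by (simp add: tree_bags_def)
        then obtain x where x: "x \<in> pverts T0" "v \<in> B0 x"
          by (auto simp: connected_conv bag_nodes_def)
        have "B0 x \<subseteq> pverts G" using tb x(1) by (simp add: tree_bags_def)
        then have "finite (B0 x)" using G.pair_finite_verts by (rule finite_subset)
        then show False using bags[OF x(1)] x(2) True by auto
      qed
      then have "pverts G = {}" by blast
      then show ?thesis by simp
    next
      case k: False
      have "k * 2 \<le> k * d" using assms(3) by simp
      moreover have "card (pverts G) < 4 * k" using False k by simp
      moreover have "18 * k * d = 18 * (k * d)" by simp
      ultimately show ?thesis by linarith
    qed
    moreover have "children {[]} [] = {}" by (auto simp: children_def)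
    ultimately show ?thesis
      by (intro that[OF slick_decomposition_singleton]) auto
  qed
  obtain T :: "nat pair_pre_digraph" and r B' where T:
    "weak_tree_decomposition G T B'" "r \<in> pverts T" "slick (d - 1) G T r B'"
    "card (pverts T) = card X" "B' ` pverts T = B ` X"
    "max_degree T \<le> 6 * d" "\<forall>v. spread T B' v = card {x \<in> X. v \<in> B x}"
    by (rule slick_decomposition_realize[OF X assms(1) deg], assumption, rule that)
  have "width T B' \<le> int (18 * k * d)"
  proof -
    note lt = list_treeD[OF slick_decompositionD(1)[OF X]]
    have "(\<lambda>x. card (B' x)) ` pverts T = card ` B ` X"
      unfolding T(5)[symmetric] by (simp add: image_image)
    moreover have "Max (card ` B ` X) \<le> 18 * k * d + 1"
      using lt bag by (subst Max_le_iff) auto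
    ultimately have "Max ((\<lambda>x. card (B' x)) ` pverts T) \<le> 18 * k * d + 1" by simp
    then show ?thesis unfolding width_def by linarith
  qed
  moreover have "real (spread T B' v) \<le> 1 + real (degree G v) / (real d - 1)"
    if v: "v \<in> pverts G" for v
  proof -
    have "(spread T B' v - 1) * (d - 1) \<le> degree G v"
      using slick_decomposition_spread[OF X assms(1) v] unfolding T(7)[rule_format] .
    then have "real ((spread T B' v - 1) * (d - 1)) \<le> real (degree G v)" by (rule of_nat_mono)
    then have "real (spread T B' v - 1) * (real d - 1) \<le> real (degree G v)"
      using assms(3) by (simp add: of_nat_diff)
    then have "real (spread T B' v - 1) \<le> real (degree G v) / (real d - 1)"
      using assms(3) by (simp add: field_simps)
    \<comment> \<open>The subtraction is truncated, but \<open>real n \<le> real (n - 1) + 1\<close>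
      also holds for \<open>n = 0\<close>.\<close>
    then show ?thesis by linarith
  qed
  ultimately show ?thesis
    using T(1-4,6) order by (intro exI[of _ T] exI[of _ r] exI[of _ B']) simp
qed

end
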